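(* Let $p\in(1,+\infty)$ and $\mathcal A(\boldsymbol\tau)=|\boldsymbol\tau|^{p-2}\boldsymbol\tau$ for $\boldsymbol\tau\in\mathbb R^d$ (with $\mathcal A(\boldsymbol 0)=\boldsymbol 0$). The following two problems have the same solutions. (Weak form) Find $u_h\in V_h$ such that for all $v_h\in V_h$: $$\begin{aligned}&(\mathcal A(D_{DG}(u_h;g_D)),D_{DG}(v_h;0))_\Omega+\langle\eta\mathcal A(h_e^{-1}[\![u_h]\!]),[\![v_h]\!]\rangle_{\Gamma^o}+\langle\eta\mathcal A(h_e^{-1}(u_h-g_D)\boldsymbol n),v_h\boldsymbol n\rangle_{\Gamma^D}\\&\quad=(f,v_h)_\Omega+\langle\boldsymbol g_N\cdot\boldsymbol n,v_h\rangle_{\Gamma^N}.\end{aligned}$$ (Minimization form) Find $u_h\in V_h$ such that $J_h(u_h)=\min_{v_h\in V_h}J_h(v_h)$, where $$J_h(v_h)=\tfrac1p\|D_{DG}(v_h;g_D)\|_{L^p(\Omega)}^p+\tfrac1p\|[\![v_h]\!]\|_{L^p(\Gamma^o,\eta h_e^{1-p})}^p+\tfrac1p\|v_h-g_D\|_{L^p(\Gamma^D,\eta h_e^{1-p})}^p-(f,v_h)_\Omega-\langle \boldsymbol g_N\cdot\boldsymbol n,v_h\rangle_{\Gamma^N}.$$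
   Context: Setting. $\frac1p+\frac1{p'}=1$. $\Omega\subset\mathbb R^d$ is a polyhedral open bounded connected set with $\partial\Omega=\Gamma^D\sqcup\Gamma^N$ and $|\Gamma^D|>0$. Data: $f\in L^{p'}(\Omega)\cap W^{-1,p'}(\Omega)$, $g_D\in W^{1/p',p}(\Gamma^D)$, $\boldsymbol g_N\cdot\boldsymbol n\in L^{p'}(\Gamma^N)\cap W^{-1/p',p'}(\Gamma^N)$. $(\cdot,\cdot)_D$ and $\langle\cdot,\cdot\rangle_e$ are the integral pairings on a domain and on a $(d-1)$-dimensional set (for vector-valued functions, using the Euclidean inner product); $\|v\|_{L^p(S,w)}=(\int_S|v|^p w)^{1/p}$. $\mathbb N$ contains $0$. Mesh. $\mathcal T_h$ is a finite partition of $\Omega$ into simplices $K$; two distinct elements are disjoint or share only part of one common face; each face is interior (distinct elements on both sides) or a boundary face contained in exactly one of $\Gamma^D,\Gamma^N$. $\Gamma^o$ is the union of interior faces; $\boldsymbol n$ is the unit outward normal. $h_e>0$ is the shortest normal characteristic length of the face $e$ (e.g. the minimum height over $e$ of the neighboring elements). $\eta>0$ (scalar) and $\boldsymbol C_{12}\in\mathbb R^d$ are constant on each face. Spaces. For fixed $k\in\mathbb N$, $V_h=\bigoplus_{K}\mathcal P^k(K)$ and $Q_h=\Sigma_h=\bigoplus_K(\mathcal P^k(K))^d$ (piecewise polynomials of total degree at most $k$, no continuity imposed). $\nabla_h$ is the elementwise gradient. Jumps and averages. On an interior face shared by $K_1,K_2$ with outward normals $\boldsymbol n_1=-\boldsymbol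 n_2$: $[\![q]\!]=q_1\boldsymbol n_1+q_2\boldsymbol n_2$, $[\![\boldsymbol\varphi]\!]=\boldsymbol\varphi_1\cdot\boldsymbol n_1+\boldsymbol\varphi_2\cdot\boldsymbol n_2$, and $\{\!\{\cdot\}\!\}$ is the arithmetic mean of the two traces. On a boundary face $[\![q]\!]=q\boldsymbol n$ and $\{\!\{\boldsymbol\varphi\}\!\}=\boldsymbol\varphi$. Discrete gradient. For $v$ in the broken space $W^{1,1}(\mathcal T_h)=\{v: v|_K\in W^{1,1}(K)\ \forall K\}$ and $g\in L^1(\Gamma^D)$, $D_{DG}(v;g)\in Q_h$ is defined by: for all $\boldsymbol\zeta_h\in\Sigma_h$, $$(D_{DG}(v;g),\boldsymbol\zeta_h)_\Omega=(\nabla_hv,\boldsymbol\zeta_h)_\Omega-\langle[\![v]\!],\{\!\{\boldsymbol\zeta_h\}\!\}-\boldsymbol C_{12}[\![\boldsymbol\zeta_h]\!]\rangle_{\Gamma^o}-\langle v-g,\boldsymbol\zeta_h\cdot\boldsymbol n\rangle_{\Gamma^D}.$$ *)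

theory Defs
  imports "HOL-Analysis.Analysis"
begin

section \<open>Domain and mesh\<close>

text \<open>Taking the interior of a union of polytopes excludes slits, i.e. boundary pieces with the domain
  on both sides.  (The library's polyhedron is a \<^emph>\<open>convex\<close> polyhedron.)\<close>

definition polyhedral_domain :: "'a::euclidean_space set \<Rightarrow> bool" where
  "polyhedral_domain \<Omega> \<longleftrightarrow> open \<Omega> \<and> bounded \<Omega> \<and> connected \<Omega> \<and>
     (\<exists>\<P>. finite \<P> \<and> (\<forall>P\<in>\<P>. polytope P) \<and> \<Omega> = interior (\<Union>\<P>))"

text \<open>Elements are closed simplices; they partition the domain up to their boundaries.  Since two
  elements need only share \<^emph>\<open>part\<close> of a facet, hanging nodes are allowed, and an interior face is the
  \<open>(d-1)\<close>-dimensional intersection of two distinct elements, not necessarily a whole facet.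
  The last condition says that every facet consists of interior faces or lies on the boundary.\<close>

definition interior_faces :: "'a::euclidean_space set set \<Rightarrow> 'a set set" where
  "interior_faces T =
     {K1 \<inter> K2 | K1 K2. K1 \<in> T \<and> K2 \<in> T \<and> K1 \<noteq> K2 \<and> aff_dim (K1 \<inter> K2) = int DIM('a) - 1}"

definition boundary_faces :: "'a::euclidean_space set \<Rightarrow> 'a set set \<Rightarrow> 'a set set" where
  "boundary_faces \<Omega> T = {F. (\<exists>K\<in>T. F facet_of K) \<and> F \<subseteq> frontier \<Omega>}"

definition simplicial_mesh :: "'a::euclidean_space set \<Rightarrow> 'a set set \<Rightarrow> bool" where
  "simplicial_mesh \<Omega> T \<longleftrightarrow>
     finite T \<and> (\<forall>K\<in>T. int DIM('a) simplex K) \<and>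
     \<Union>T = closure \<Omega> \<and>
     pairwise (\<lambda>K K'. interior K \<inter> interior K' = {}) T \<and>
     pairwise (\<lambda>K K'. K \<inter> K' = {} \<or>
        (\<exists>F F'. F facet_of K \<and> F' facet_of K' \<and> K \<inter> K' \<subseteq> F \<inter> F')) T \<and>
     (\<forall>K\<in>T. \<forall>F. F facet_of K \<longrightarrow>
        F \<in> boundary_faces \<Omega> T \<or> F = \<Union>{e \<in> interior_faces T. e \<subseteq> F})"

text \<open>Faces are closed sets, so adjacent faces of the disjoint parts \<open>\<Gamma>\<^sup>D\<close> and \<open>\<Gamma>\<^sup>N\<close> of the boundary
  overlap in a null set; a face belongs to a part of the boundary if its relative interior does.\<close>

definition faces_in :: "'a::euclidean_space set \<Rightarrow> 'a set set \<Rightarrow> 'a set \<Rightarrow> 'a set set" where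
  "faces_in \<Omega> T \<Gamma> = {e \<in> boundary_faces \<Omega> T. rel_interior e \<subseteq> \<Gamma>}"

text \<open>An interior face has exactly two adjacent elements, a boundary face exactly one.\<close>

definition adjacent :: "'a set set \<Rightarrow> 'a set \<Rightarrow> 'a set set" where
  "adjacent T e = {K \<in> T. e \<subseteq> K}"

text \<open>The element at a boundary face.\<close>

definition bd_elem :: "'a set set \<Rightarrow> 'a set \<Rightarrow> 'a set" where
  "bd_elem T e = (SOME K. K \<in> adjacent T e)"

text \<open>Unit outward normal of \<open>K\<close> on \<open>e\<close>; unique, as \<open>e\<close> spans a hyperplane and \<open>K\<close> has interior points.\<close>

definition outward_normal :: "'a::euclidean_space set \<Rightarrow> 'a set \<Rightarrow> 'a" where
  "outward_normal K e =
     (SOME n. norm n = 1 \<and> (\<exists>c. (\<forall>x\<in>e. n \<bullet> x = c) \<and> (\<forall>x\<in>K. n \<bullet> x \<le> c)))"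

definition bd_normal :: "'a::euclidean_space set set \<Rightarrow> 'a set \<Rightarrow> 'a" where
  "bd_normal T e = outward_normal (bd_elem T e) e"


section \<open>Integrals on the domain and on faces\<close>

text \<open>Lebesgue measure on the affine hull of \<open>e\<close>, in orthonormal coordinates \<open>t\<close> on the hull (it does
  not depend on the choice of the origin and of the orthonormal basis).  For a face this is
  \<open>(d-1)\<close>-dimensional measure; if \<open>d = 1\<close> it is the point mass.\<close>

definition tangent_basis :: "'a::euclidean_space set \<Rightarrow> 'a set" where
  "tangent_basis e = (SOME B. pairwise orthogonal B \<and> (\<forall>b\<in>B. norm b = 1) \<and>
     span B = {x - y | x y. x \<in> affine hull e \<and> y \<in> affine hull e})"

definition face_measure :: "'a::euclidean_space set \<Rightarrow> 'a measure" where
  "face_measure e = completion (distr (\<Pi>\<^sub>M b\<in>tangent_basis e. lborel) borel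
     (\<lambda>t. (SOME a. a \<in> e) + (\<Sum>b\<in>tangent_basis e. t b *\<^sub>R b)))"

text \<open>The pairings \<open>(\<cdot>,\<cdot>)\<^sub>\<Omega>\<close> and \<open>\<langle>\<cdot>,\<cdot>\<rangle>\<close>, the latter on a union of faces.  On the skeleton, integrands are
  indexed by the face as well as by the point; on the reals, the inner product is multiplication.\<close>

definition dom_pair :: "'a::euclidean_space set \<Rightarrow> ('a \<Rightarrow> 'b::real_inner) \<Rightarrow> ('a \<Rightarrow> 'b) \<Rightarrow> real" where
  "dom_pair \<Omega> u w = (LINT x:\<Omega>|lebesgue. u x \<bullet> w x)"

definition face_pair ::
  "'a::euclidean_space set set \<Rightarrow> ('a set \<Rightarrow> 'a \<Rightarrow> 'b::real_inner) \<Rightarrow> ('a set \<Rightarrow> 'a \<Rightarrow> 'b) \<Rightarrow> real" where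
  "face_pair E u w = (\<Sum>e\<in>E. LINT x:e|face_measure e. u e x \<bullet> w e x)"

definition dom_Lp_norm :: "real \<Rightarrow> 'a::euclidean_space set \<Rightarrow> ('a \<Rightarrow> 'b::real_normed_vector) \<Rightarrow> real" where
  "dom_Lp_norm p \<Omega> u = (LINT x:\<Omega>|lebesgue. norm (u x) powr p) powr (1 / p)"

text \<open>The weight is constant on each face.\<close>

definition face_Lp_norm ::
  "real \<Rightarrow> 'a::euclidean_space set set \<Rightarrow> ('a set \<Rightarrow> real) \<Rightarrow> ('a set \<Rightarrow> 'a \<Rightarrow> 'b::real_normed_vector) \<Rightarrow> real" where
  "face_Lp_norm p E w u =
     (\<Sum>e\<in>E. LINT x:e|face_measure e. norm (u e x) powr p * w e) powr (1 / p)"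


section \<open>Function spaces of the data\<close>

definition Lp_on :: "real \<Rightarrow> 'a measure \<Rightarrow> 'a set \<Rightarrow> ('a \<Rightarrow> real) \<Rightarrow> bool" where
  "Lp_on p M S f \<longleftrightarrow> set_borel_measurable M S f \<and> set_integrable M S (\<lambda>x. \<bar>f x\<bar> powr p)"

definition grad :: "('a::euclidean_space \<Rightarrow> real) \<Rightarrow> 'a \<Rightarrow> 'a" where
  "grad \<phi> x = (THE D. GDERIV \<phi> x :> D)"

primrec C_k :: "nat \<Rightarrow> ('a::euclidean_space \<Rightarrow> real) \<Rightarrow> bool" where
  "C_k 0 \<phi> \<longleftrightarrow> continuous_on UNIV \<phi>"
| "C_k (Suc m) \<phi> \<longleftrightarrow> (\<forall>x. \<phi> differentiable (at x)) \<and> (\<forall>b\<in>Basis. C_k m (\<lambda>x. grad \<phi> x \<bullet> b))"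

definition test_functions :: "'a::euclidean_space set \<Rightarrow> ('a \<Rightarrow> real) set" where
  "test_functions \<Omega> =
     {\<phi>. (\<forall>m. C_k m \<phi>) \<and> compact (closure {x. \<phi> x \<noteq> 0}) \<and> closure {x. \<phi> x \<noteq> 0} \<subseteq> \<Omega>}"

definition W1p_norm :: "real \<Rightarrow> 'a::euclidean_space set \<Rightarrow> ('a \<Rightarrow> real) \<Rightarrow> real" where
  "W1p_norm p \<Omega> \<phi> = ((LINT x:\<Omega>|lebesgue. \<bar>\<phi> x\<bar> powr p) +
     (LINT x:\<Omega>|lebesgue. norm (grad \<phi> x) powr p)) powr (1 / p)"

text \<open>\<open>f\<close> belongs to \<open>L\<^sup>p\<^sup>' \<inter> W\<^sup>-\<^sup>1\<^sup>,\<^sup>p\<^sup>'\<close>: the functional defined by \<open>f\<close> is bounded for the \<open>W\<^sup>1\<^sup>,\<^sup>p\<close> norm on test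
  functions, which are dense in \<open>W\<^sub>0\<^sup>1\<^sup>,\<^sup>p\<close>.\<close>

definition dual_data_dom :: "real \<Rightarrow> real \<Rightarrow> 'a::euclidean_space set \<Rightarrow> ('a \<Rightarrow> real) \<Rightarrow> bool" where
  "dual_data_dom p p' \<Omega> f \<longleftrightarrow> Lp_on p' lebesgue \<Omega> f \<and>
     (\<exists>C. \<forall>\<phi>\<in>test_functions \<Omega>. \<bar>dom_pair \<Omega> f \<phi>\<bar> \<le> C * W1p_norm p \<Omega> \<phi>)"

text \<open>The Sobolev-Slobodeckij space \<open>W\<^sup>s\<^sup>,\<^sup>p\<close> on a union of faces, which has dimension \<open>d - 1\<close>.\<close>

definition slob_kernel :: "real \<Rightarrow> real \<Rightarrow> ('a::euclidean_space \<Rightarrow> real) \<Rightarrow> 'a \<times> 'a \<Rightarrow> real" where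
  "slob_kernel s p g = (\<lambda>(x, y). \<bar>g x - g y\<bar> powr p / norm (x - y) powr (real DIM('a) - 1 + s * p))"

definition Wsp_faces :: "real \<Rightarrow> real \<Rightarrow> 'a::euclidean_space set set \<Rightarrow> ('a \<Rightarrow> real) set" where
  "Wsp_faces s p E = {g. (\<forall>e\<in>E. Lp_on p (face_measure e) e g) \<and>
     (\<forall>e\<in>E. \<forall>e'\<in>E. set_integrable (face_measure e \<Otimes>\<^sub>M face_measure e') (e \<times> e') (slob_kernel s p g))}"

definition Wsp_faces_norm :: "real \<Rightarrow> real \<Rightarrow> 'a::euclidean_space set set \<Rightarrow> ('a \<Rightarrow> real) \<Rightarrow> real" where
  "Wsp_faces_norm s p E g =
     ((\<Sum>e\<in>E. LINT x:e|face_measure e. \<bar>g x\<bar> powr p) +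
      (\<Sum>e\<in>E. \<Sum>e'\<in>E. LINT z:e \<times> e'|face_measure e \<Otimes>\<^sub>M face_measure e'. slob_kernel s p g z)) powr (1 / p)"

text \<open>\<open>g\<close> belongs to \<open>L\<^sup>p\<^sup>' \<inter> W\<^sup>-\<^sup>s\<^sup>,\<^sup>p\<^sup>'\<close> on a union of faces, with \<open>W\<^sup>-\<^sup>s\<^sup>,\<^sup>p\<^sup>'\<close> the dual of \<open>W\<^sup>s\<^sup>,\<^sup>p\<close>.\<close>

definition dual_data_faces ::
  "real \<Rightarrow> real \<Rightarrow> real \<Rightarrow> 'a::euclidean_space set set \<Rightarrow> ('a set \<Rightarrow> 'a \<Rightarrow> real) \<Rightarrow> bool" where
  "dual_data_faces s p p' E g \<longleftrightarrow> (\<forall>e\<in>E. Lp_on p' (face_measure e) e (g e)) \<and>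
     (\<exists>C. \<forall>\<phi>\<in>Wsp_faces s p E. \<bar>face_pair E g (\<lambda>e. \<phi>)\<bar> \<le> C * Wsp_faces_norm s p E \<phi>)"


section \<open>Broken polynomial spaces\<close>

definition Poly :: "nat \<Rightarrow> ('a::euclidean_space \<Rightarrow> real) set" where
  "Poly k = range (\<lambda>c x. \<Sum>\<alpha> | \<alpha> \<in> Basis \<rightarrow>\<^sub>E (UNIV :: nat set) \<and> (\<Sum>b\<in>Basis. \<alpha> b) \<le> k.
                  c \<alpha> * (\<Prod>b\<in>Basis. (x \<bullet> b) ^ \<alpha> b))"

text \<open>A broken function is a family indexed by the elements.  A polynomial on a simplex is identified
  with the polynomial on the whole space, so that its gradient and its traces on the faces of the simplex
  are those of the polynomial.\<close>

definition V_h :: "nat \<Rightarrow> 'a::euclidean_space set set \<Rightarrow> ('a set \<Rightarrow> 'a \<Rightarrow> real) set" where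
  "V_h k T = (\<Pi>\<^sub>E K\<in>T. Poly k)"

definition Q_h :: "nat \<Rightarrow> 'a::euclidean_space set set \<Rightarrow> ('a set \<Rightarrow> 'a \<Rightarrow> 'a) set" where
  "Q_h k T = (\<Pi>\<^sub>E K\<in>T. {q. \<forall>b\<in>Basis. (\<lambda>x. q x \<bullet> b) \<in> Poly k})"

text \<open>The function on the domain given by a broken function (set to 0 on the skeleton, a null set).\<close>

definition pw :: "'a::euclidean_space set set \<Rightarrow> ('a set \<Rightarrow> 'a \<Rightarrow> 'b::real_vector) \<Rightarrow> 'a \<Rightarrow> 'b" where
  "pw T v x = (\<Sum>K | K \<in> T \<and> x \<in> interior K. v K x)"

definition broken_grad :: "('a::euclidean_space set \<Rightarrow> 'a \<Rightarrow> real) \<Rightarrow> 'a set \<Rightarrow> 'a \<Rightarrow> 'a" where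
  "broken_grad v K = grad (v K)"

definition jump :: "'a::euclidean_space set set \<Rightarrow> ('a set \<Rightarrow> 'a \<Rightarrow> real) \<Rightarrow> 'a set \<Rightarrow> 'a \<Rightarrow> 'a" where
  "jump T q e x = (\<Sum>K\<in>adjacent T e. q K x *\<^sub>R outward_normal K e)"

definition njump :: "'a::euclidean_space set set \<Rightarrow> ('a set \<Rightarrow> 'a \<Rightarrow> 'a) \<Rightarrow> 'a set \<Rightarrow> 'a \<Rightarrow> real" where
  "njump T \<phi> e x = (\<Sum>K\<in>adjacent T e. \<phi> K x \<bullet> outward_normal K e)"

definition avg :: "'a::euclidean_space set set \<Rightarrow> ('a set \<Rightarrow> 'a \<Rightarrow> 'a) \<Rightarrow> 'a set \<Rightarrow> 'a \<Rightarrow> 'a" where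
  "avg T \<phi> e x = (1 / real (card (adjacent T e))) *\<^sub>R (\<Sum>K\<in>adjacent T e. \<phi> K x)"

definition bd_trace :: "'a set set \<Rightarrow> ('a set \<Rightarrow> 'a \<Rightarrow> 'b) \<Rightarrow> 'a set \<Rightarrow> 'a \<Rightarrow> 'b" where
  "bd_trace T v e = v (bd_elem T e)"


section \<open>Discrete gradient and the two problems\<close>

text \<open>Used for \<open>v\<close> in \<^term>\<open>V_h k T\<close> only, so that classical gradients and traces suffice.\<close>

definition D_DG ::
  "nat \<Rightarrow> 'a::euclidean_space set \<Rightarrow> 'a set \<Rightarrow> 'a set set \<Rightarrow> ('a set \<Rightarrow> 'a) \<Rightarrow>
   ('a set \<Rightarrow> 'a \<Rightarrow> real) \<Rightarrow> ('a \<Rightarrow> real) \<Rightarrow> 'a set \<Rightarrow> 'a \<Rightarrow> 'a" where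
  "D_DG k \<Omega> \<Gamma>D T C12 v g = (THE q. q \<in> Q_h k T \<and> (\<forall>\<zeta>\<in>Q_h k T.
     dom_pair \<Omega> (pw T q) (pw T \<zeta>) =
       dom_pair \<Omega> (pw T (broken_grad v)) (pw T \<zeta>)
       - face_pair (interior_faces T) (jump T v) (\<lambda>e x. avg T \<zeta> e x - njump T \<zeta> e x *\<^sub>R C12 e)
       - face_pair (faces_in \<Omega> T \<Gamma>D) (\<lambda>e x. bd_trace T v e x - g x)
           (\<lambda>e x. bd_trace T \<zeta> e x \<bullet> bd_normal T e)))"

definition A_p :: "real \<Rightarrow> 'a::real_normed_vector \<Rightarrow> 'a" where
  "A_p p \<tau> = (norm \<tau> powr (p - 2)) *\<^sub>R \<tau>"

definition weak_solution ::
  "real \<Rightarrow> nat \<Rightarrow> 'a::euclidean_space set \<Rightarrow> 'a set \<Rightarrow> 'a set \<Rightarrow> 'a set set \<Rightarrow>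
   ('a set \<Rightarrow> real) \<Rightarrow> ('a set \<Rightarrow> real) \<Rightarrow> ('a set \<Rightarrow> 'a) \<Rightarrow>
   ('a \<Rightarrow> real) \<Rightarrow> ('a \<Rightarrow> real) \<Rightarrow> ('a \<Rightarrow> 'a) \<Rightarrow> ('a set \<Rightarrow> 'a \<Rightarrow> real) \<Rightarrow> bool" where
  "weak_solution p k \<Omega> \<Gamma>D \<Gamma>N T h \<eta> C12 f gD gN u \<longleftrightarrow> u \<in> V_h k T \<and> (\<forall>v\<in>V_h k T.
     dom_pair \<Omega> (\<lambda>x. A_p p (pw T (D_DG k \<Omega> \<Gamma>D T C12 u gD) x)) (pw T (D_DG k \<Omega> \<Gamma>D T C12 v (\<lambda>x. 0)))
     + face_pair (interior_faces T) (\<lambda>e x. \<eta> e *\<^sub>R A_p p (inverse (h e) *\<^sub>R jump T u e x)) (jump T v)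
     + face_pair (faces_in \<Omega> T \<Gamma>D)
         (\<lambda>e x. \<eta> e *\<^sub>R A_p p ((inverse (h e) * (bd_trace T u e x - gD x)) *\<^sub>R bd_normal T e))
         (\<lambda>e x. bd_trace T v e x *\<^sub>R bd_normal T e)
     = dom_pair \<Omega> f (pw T v)
       + face_pair (faces_in \<Omega> T \<Gamma>N) (\<lambda>e x. gN x \<bullet> bd_normal T e) (bd_trace T v))"

definition J_h ::
  "real \<Rightarrow> nat \<Rightarrow> 'a::euclidean_space set \<Rightarrow> 'a set \<Rightarrow> 'a set \<Rightarrow> 'a set set \<Rightarrow>
   ('a set \<Rightarrow> real) \<Rightarrow> ('a set \<Rightarrow> real) \<Rightarrow> ('a set \<Rightarrow> 'a) \<Rightarrow>
   ('a \<Rightarrow> real) \<Rightarrow> ('a \<Rightarrow> real) \<Rightarrow> ('a \<Rightarrow> 'a) \<Rightarrow> ('a set \<Rightarrow> 'a \<Rightarrow> real) \<Rightarrow> real" where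
  "J_h p k \<Omega> \<Gamma>D \<Gamma>N T h \<eta> C12 f gD gN v =
     1 / p * dom_Lp_norm p \<Omega> (pw T (D_DG k \<Omega> \<Gamma>D T C12 v gD)) powr p
     + 1 / p * face_Lp_norm p (interior_faces T) (\<lambda>e. \<eta> e * h e powr (1 - p)) (jump T v) powr p
     + 1 / p * face_Lp_norm p (faces_in \<Omega> T \<Gamma>D) (\<lambda>e. \<eta> e * h e powr (1 - p))
         (\<lambda>e x. bd_trace T v e x - gD x) powr p
     - dom_pair \<Omega> f (pw T v)
     - face_pair (faces_in \<Omega> T \<Gamma>N) (\<lambda>e x. gN x \<bullet> bd_normal T e) (bd_trace T v)"

end

theory Submission
  imports Defs
begin

text \<open>The weak form says that the directional derivatives of the functional vanish.  Since
  \<open>|\<tau>|\<^sup>p / p\<close> is convex with gradient \<open>|\<tau>|\<^sup>p\<^sup>-\<^sup>2 \<tau>\<close>, and the discrete gradient and the jumps are affine in \<open>u\<close>,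
  integrating the subgradient inequality gives \<open>J u + t * slope u v \<le> J (u + t v)\<close>.  With slope 0 this is
  minimality.  Conversely, at a minimizer the same inequality based at \<open>u + t v\<close> fixes the sign of
  \<open>slope (u + t v) v\<close>, and dominated convergence lets \<open>t\<close> tend to 0; the functional need not be
  differentiated.  That the discrete gradient exists, is unique and is affine is Riesz representation in the
  finite-dimensional space \<open>Q\<^sub>h\<close>.\<close>

section \<open>The p-Laplace nonlinearity\<close>

text \<open>The base point has to move because the inequality based at \<open>u\<close> only bounds
  the functional from below, which is also all that minimality says; the two never collide. Based at
  \<open>u + t v\<close>, it gives an upper bound on a slope, but at the wrong point. Returning to
  \<open>u\<close> takes less than a derivative of the functional: continuity of \<open>A_p\<close>,
  also at 0 where its weight is singular for p < 2, and a bound on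
  \<open>A_p p (a + t b) \<bullet> b\<close> that is uniform for |t| <= 1. \<open>D_DG\<close> is a
  definite description, so nothing can be read off its formula before unique existence is known.
  That rests on the pairing being definite on \<open>Q_h\<close>: a polynomial that vanishes almost
  everywhere on a nonempty open set vanishes identically. The pairings in the discrete gradient and
  in the load are integrable because one factor is always polynomial, hence bounded on compact
  elements and faces of finite measure.\<close>

lemma norm_A_p: "norm (A_p p x) = norm x powr (p - 1)"
  by (cases "x = 0") (simp_all add: A_p_def powr_diff power2_eq_square)

lemma A_p_inner_self: "A_p p x \<bullet> x = norm x powr p" for x :: "'b::real_inner"
  by (cases "x = 0")
    (simp_all add: A_p_def powr_diff power2_norm_eq_inner[symmetric])

lemma A_p_scaleR:
  assumes "0 < c"
  shows "A_p p (c *\<^sub>R x) = c powr (p - 1) *\<^sub>R A_p p x"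
  using assms by (simp add: A_p_def powr_mult powr_diff power2_eq_square)

lemma A_p_scaleR_unit:
  assumes "norm n = 1"
  shows "A_p p (c *\<^sub>R n) = A_p p c *\<^sub>R n"
  using assms by (simp add: A_p_def)

lemma A_p_zero: "A_p p 0 = 0"
  by (simp add: A_p_def)

text \<open>For p < 2 the factor \<open>norm x powr (p - 2)\<close> blows up at 0, so continuity
  there is taken from \<open>norm_A_p\<close>, whose exponent p - 1 is positive.\<close>

lemma continuous_A_p:
  fixes x :: "'b::real_normed_vector"
  assumes "1 < p"
  shows "isCont (A_p p) x"
proof (cases "x = 0")
  case True
  have "((\<lambda>y::'b. norm y powr (p - 1)) \<longlongrightarrow> norm (0::'b) powr (p - 1)) (at 0)"
    using assms by (intro tendsto_powr2 tendsto_norm tendsto_ident_at tendsto_const) auto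
  then have "((\<lambda>y::'b. A_p p y) \<longlongrightarrow> 0) (at 0)"
    by (intro tendsto_norm_zero_cancel[where f = "A_p p"]) (simp add: norm_A_p)
  then show ?thesis
    using True by (simp add: isCont_def A_p_zero)
next
  case False
  then show ?thesis
    unfolding A_p_def by (intro continuous_intros) auto
qed

lemma A_p_measurable [measurable]:
  fixes a :: "'x \<Rightarrow> 'b::euclidean_space"
  assumes [measurable]: "a \<in> borel_measurable M"
  shows "(\<lambda>x. A_p p (a x)) \<in> borel_measurable M"
  unfolding A_p_def by measurable

text \<open>Cauchy-Schwarz, then Young's inequality for |y| and |a|^(p-1). No derivative of the norm
  is taken, so a = 0 is no special case.\<close>

lemma norm_powr_subgradient:
  fixes a y :: "'b::real_inner"
  assumes p: "1 < p"
  shows "1 / p * norm a powr p + A_p p a \<bullet> (y - a) \<le> 1 / p * norm y powr p"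
proof -
  \<comment> \<open>The exponent conjugate to p; raising |a|^(p-1) to it gives back |a|^p.\<close>
  define q where "q = p / (p - 1)"
  have q: "1 < q" "1 / p + 1 / q = 1" and pq: "(p - 1) * q = p"
    using p by (auto simp: q_def field_simps)
  have "A_p p a \<bullet> y \<le> norm y * norm a powr (p - 1)"
    using norm_cauchy_schwarz[of "A_p p a" y] by (simp add: norm_A_p mult.commute)
  also have "\<dots> \<le> norm y powr p / p + (norm a powr (p - 1)) powr q / q"
    using p q by (intro Youngs_inequality) auto
  also have "(norm a powr (p - 1)) powr q = norm a powr p"
    by (simp add: powr_powr pq)
  also have "norm a powr p / q = norm a powr p - norm a powr p / p"
    using q by (metis add_diff_cancel_left' right_diff_distrib mult.right_neutral times_divide_eq_right)
  finally show ?thesis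
    by (simp add: inner_diff_right A_p_inner_self)
qed

text \<open>A sum is at most twice the maximum, whence the constant 2^p. It is not sharp, but it
  serves both for sums in Lp and for domination.\<close>

lemma norm_add_powr_le:
  fixes x y :: "'b::real_normed_vector"
  assumes "0 \<le> p"
  shows "(norm x + norm y) powr p \<le> 2 powr p * (norm x powr p + norm y powr p)"
proof -
  have "(norm x + norm y) powr p \<le> (2 * max (norm x) (norm y)) powr p"
    using assms by (intro powr_mono2) auto
  also have "\<dots> = 2 powr p * max (norm x) (norm y) powr p"
    by (simp add: powr_mult)
  also have "\<dots> \<le> 2 powr p * (norm x powr p + norm y powr p)"
    by (auto simp: max_def)
  finally show ?thesis .
qed

section \<open>The p-th power functional\<close>

text \<open>The class of broken polynomials and their traces. The bound holds at every point, so it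
  can be inserted under an integral without null sets.\<close>

definition bdd_meas :: "'x measure \<Rightarrow> ('x \<Rightarrow> 'b::euclidean_space) \<Rightarrow> bool" where
  "bdd_meas M a \<longleftrightarrow> a \<in> borel_measurable M \<and> (\<exists>C. \<forall>x\<in>space M. norm (a x) \<le> C)"

definition Lp_fun :: "real \<Rightarrow> 'x measure \<Rightarrow> ('x \<Rightarrow> 'b::euclidean_space) \<Rightarrow> bool" where
  "Lp_fun p M a \<longleftrightarrow> a \<in> borel_measurable M \<and> integrable M (\<lambda>x. norm (a x) powr p)"

definition p_energy :: "real \<Rightarrow> 'x measure \<Rightarrow> ('x \<Rightarrow> 'b::euclidean_space) \<Rightarrow> real" where
  "p_energy p M a = (LINT x|M. norm (a x) powr p)"

definition p_slope :: "real \<Rightarrow> 'x measure \<Rightarrow> ('x \<Rightarrow> 'b::euclidean_space) \<Rightarrow> ('x \<Rightarrow> 'b) \<Rightarrow> real" where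
  "p_slope p M a b = (LINT x|M. A_p p (a x) \<bullet> b x)"

lemma bdd_measE:
  assumes "bdd_meas M a"
  obtains C where "0 \<le> C" "\<And>x. x \<in> space M \<Longrightarrow> norm (a x) \<le> C"
  using assms unfolding bdd_meas_def by (meson abs_ge_self abs_ge_zero order_trans)

lemma bdd_meas_inner_integrable:
  assumes "bdd_meas M a" "integrable M b"
  shows "integrable M (\<lambda>x. a x \<bullet> b x)" "integrable M (\<lambda>x. b x \<bullet> a x)"
proof -
  obtain C where C: "0 \<le> C" "\<And>x. x \<in> space M \<Longrightarrow> norm (a x) \<le> C"
    using bdd_measE[OF assms(1)] by metis
  have [measurable]: "a \<in> borel_measurable M" "b \<in> borel_measurable M"
    using assms by (auto simp: bdd_meas_def)
  have "integrable M (\<lambda>x. C * norm (b x))"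
    using assms(2) by simp
  then show "integrable M (\<lambda>x. a x \<bullet> b x)"
  proof (rule Bochner_Integration.integrable_bound)
    show "AE x in M. norm (a x \<bullet> b x) \<le> norm (C * norm (b x))"
    proof (rule AE_I2)
      fix x assume "x \<in> space M"
      then have "norm (a x) * norm (b x) \<le> C * norm (b x)"
        using C by (intro mult_right_mono) auto
      then show "norm (a x \<bullet> b x) \<le> norm (C * norm (b x))"
        using Cauchy_Schwarz_ineq2[of "a x" "b x"] C(1) by (simp add: abs_mult)
    qed
  qed measurable
  then show "integrable M (\<lambda>x. b x \<bullet> a x)"
    by (simp add: inner_commute)
qed

context finite_measure
begin

lemma bdd_meas_integrable: "bdd_meas M a \<Longrightarrow> integrable M a"
  unfolding bdd_meas_def by (auto intro: integrable_const_bound)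

lemma bdd_meas_Lp_fun:
  assumes "bdd_meas M a" "0 \<le> p"
  shows "Lp_fun p M a"
proof -
  obtain C where C: "0 \<le> C" "\<And>x. x \<in> space M \<Longrightarrow> norm (a x) \<le> C"
    using bdd_measE[OF assms(1)] by metis
  have [measurable]: "a \<in> borel_measurable M"
    using assms by (auto simp: bdd_meas_def)
  have "integrable M (\<lambda>x. norm (a x) powr p)"
    using C assms(2) by (intro integrable_const_bound[of _ "C powr p"]) (auto intro!: powr_mono2)
  then show ?thesis
    by (simp add: Lp_fun_def)
qed

lemma Lp_fun_integrable:
  assumes "Lp_fun p M a" "1 \<le> p"
  shows "integrable M a"
proof (rule Bochner_Integration.integrable_bound)
  show "integrable M (\<lambda>x. 1 + norm (a x) powr p)" "a \<in> borel_measurable M"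
    using assms by (auto simp: Lp_fun_def)
  \<comment> \<open>The summand 1 covers t <= 1; it is integrable since the measure is
    finite.\<close>
  have "t \<le> 1 + t powr p" if "0 \<le> t" for t :: real
  proof (cases "t \<le> 1")
    case False
    then have "t powr 1 \<le> t powr p"
      using assms(2) by (intro powr_mono) auto
    then show ?thesis using False by simp
  qed (use that in \<open>simp add: add_increasing2\<close>)
  then show "AE x in M. norm (a x) \<le> norm (1 + norm (a x) powr p)"
    by (intro AE_I2) simp
qed

end

lemma Lp_fun_scaleR: "Lp_fun p M a \<Longrightarrow> Lp_fun p M (\<lambda>x. t *\<^sub>R a x)"
  by (auto simp: Lp_fun_def powr_mult)

lemma Lp_fun_add:
  assumes "Lp_fun p M a" "Lp_fun p M b" "0 \<le> p"
  shows "Lp_fun p M (\<lambda>x. a x + b x)"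
  unfolding Lp_fun_def
proof
  have [measurable]: "a \<in> borel_measurable M" "b \<in> borel_measurable M"
    using assms by (auto simp: Lp_fun_def)
  show "(\<lambda>x. a x + b x) \<in> borel_measurable M"
    by simp
  have "integrable M (\<lambda>x. 2 powr p * (norm (a x) powr p + norm (b x) powr p))"
    using assms by (auto simp: Lp_fun_def)
  then show "integrable M (\<lambda>x. norm (a x + b x) powr p)"
  proof (rule Bochner_Integration.integrable_bound)
    have "norm (a x + b x) powr p \<le> 2 powr p * (norm (a x) powr p + norm (b x) powr p)" for x
      using norm_add_powr_le[OF assms(3), of "a x" "b x"] norm_triangle_ineq[of "a x" "b x"] assms(3)
      by (meson norm_ge_zero order_trans powr_mono2)
    then show "AE x in M. norm (norm (a x + b x) powr p)
        \<le> norm (2 powr p * (norm (a x) powr p + norm (b x) powr p))"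
      by (intro AE_I2) simp
  qed measurable
qed

text \<open>The right-hand side does not depend on t, so it dominates a whole sequence of slopes at
  once; t = 0 gives integrability of a single slope. Both |a + tb| and |b| are at most |a| + |b|,
  and the exponents p - 1 and 1 add up to p.\<close>

lemma A_p_inner_bound:
  fixes a b :: "'b::real_inner"
  assumes "1 \<le> p" "\<bar>t\<bar> \<le> 1"
  shows "\<bar>A_p p (a + t *\<^sub>R b) \<bullet> b\<bar> \<le> 2 powr p * (norm a powr p + norm b powr p)"
proof -
  define s where "s = norm a + norm b"
  have "\<bar>t\<bar> * norm b \<le> 1 * norm b"
    using assms by (intro mult_right_mono) auto
  then have 1: "norm (a + t *\<^sub>R b) \<le> s"
    using norm_triangle_ineq[of a "t *\<^sub>R b"] by (simp add: s_def)
  have "\<bar>A_p p (a + t *\<^sub>R b) \<bullet> b\<bar> \<le> norm (A_p p (a + t *\<^sub>R b)) * norm b"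
    by (rule Cauchy_Schwarz_ineq2)
  also have "\<dots> \<le> s powr (p - 1) * s"
    unfolding norm_A_p using 1 assms
    by (intro mult_mono powr_mono2) (auto simp: s_def)
  also have "\<dots> = s powr p"
    by (cases "s = 0") (auto simp: powr_diff s_def)
  also have "\<dots> \<le> 2 powr p * (norm a powr p + norm b powr p)"
    unfolding s_def using assms by (intro norm_add_powr_le) auto
  finally show ?thesis .
qed

lemma p_slope_integrable:
  assumes "1 < p" "Lp_fun p M a" "Lp_fun p M b"
  shows "integrable M (\<lambda>x. A_p p (a x) \<bullet> b x)"
proof (rule Bochner_Integration.integrable_bound)
  have [measurable]: "a \<in> borel_measurable M" "b \<in> borel_measurable M"
    using assms by (auto simp: Lp_fun_def)
  show "integrable M (\<lambda>x. 2 powr p * (norm (a x) powr p + norm (b x) powr p))"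
    using assms by (auto simp: Lp_fun_def)
  show "(\<lambda>x. A_p p (a x) \<bullet> b x) \<in> borel_measurable M"
    by measurable
  show "AE x in M. norm (A_p p (a x) \<bullet> b x) \<le> norm (2 powr p * (norm (a x) powr p + norm (b x) powr p))"
    using A_p_inner_bound[of p 0] assms(1) by (intro AE_I2) simp
qed

lemma p_energy_subgradient:
  assumes "1 < p" "Lp_fun p M a" "Lp_fun p M b"
  shows "1 / p * p_energy p M a + t * p_slope p M a b \<le> 1 / p * p_energy p M (\<lambda>x. a x + t *\<^sub>R b x)"
proof -
  have int: "Lp_fun p M (\<lambda>x. a x + t *\<^sub>R b x)"
    using assms by (intro Lp_fun_add Lp_fun_scaleR) auto
  have "1 / p * p_energy p M a + t * p_slope p M a b =
      (LINT x|M. 1 / p * norm (a x) powr p + t * (A_p p (a x) \<bullet> b x))"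
    unfolding p_energy_def p_slope_def using assms p_slope_integrable[OF assms]
    by (subst Bochner_Integration.integral_add) (auto simp: Lp_fun_def)
  also have "\<dots> \<le> (LINT x|M. 1 / p * norm (a x + t *\<^sub>R b x) powr p)"
  proof (rule integral_mono)
    fix x
    show "1 / p * norm (a x) powr p + t * (A_p p (a x) \<bullet> b x) \<le> 1 / p * norm (a x + t *\<^sub>R b x) powr p"
      using norm_powr_subgradient[OF assms(1), of "a x" "a x + t *\<^sub>R b x"] by simp
  qed (use assms int p_slope_integrable[OF assms] in \<open>auto simp: Lp_fun_def\<close>)
  finally show ?thesis
    by (simp add: p_energy_def)
qed

text \<open>Dominated convergence; the restriction on \<open>s\<close> is what makes the bound of
  \<open>A_p_inner_bound\<close> independent of n.\<close>

lemma p_slope_tendsto: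
  assumes "1 < p" "Lp_fun p M a" "Lp_fun p M b" "\<And>n. \<bar>s n\<bar> \<le> 1" "s \<longlonglongrightarrow> 0"
  shows "(\<lambda>n. p_slope p M (\<lambda>x. a x + s n *\<^sub>R b x) b) \<longlonglongrightarrow> p_slope p M a b"
  unfolding p_slope_def
proof (rule integral_dominated_convergence)
  have [measurable]: "a \<in> borel_measurable M" "b \<in> borel_measurable M"
    using assms by (auto simp: Lp_fun_def)
  show "integrable M (\<lambda>x. 2 powr p * (norm (a x) powr p + norm (b x) powr p))"
    using assms by (auto simp: Lp_fun_def)
  show "(\<lambda>x. A_p p (a x) \<bullet> b x) \<in> borel_measurable M"
    by measurable
  show "(\<lambda>x. A_p p (a x + s n *\<^sub>R b x) \<bullet> b x) \<in> borel_measurable M" for n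
    by measurable
  show "AE x in M. norm (A_p p (a x + s n *\<^sub>R b x) \<bullet> b x)
      \<le> 2 powr p * (norm (a x) powr p + norm (b x) powr p)" for n
    using A_p_inner_bound[OF less_imp_le[OF assms(1)] assms(4)] by (intro AE_I2) (unfold real_norm_def, fast)
  have "(\<lambda>n. a x + s n *\<^sub>R b x) \<longlonglongrightarrow> a x" for x
    using tendsto_add[OF tendsto_const tendsto_scaleR[OF assms(5) tendsto_const]] by fastforce
  then show "AE x in M. (\<lambda>n. A_p p (a x + s n *\<^sub>R b x) \<bullet> b x) \<longlonglongrightarrow> A_p p (a x) \<bullet> b x"
    by (intro AE_I2 tendsto_inner tendsto_const isCont_tendsto_compose[OF continuous_A_p[OF assms(1)]])
qed

section \<open>Riesz representation in finite dimensions\<close>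

text \<open>Linearity as one equation, in the shape of \<open>comb\<close>. Coefficient families
  take the place of a vector space type, since the dimension of the broken space depends on the mesh
  and the degree.\<close>

definition lin_fun :: "(('i \<Rightarrow> real) \<Rightarrow> real) \<Rightarrow> bool" where
  "lin_fun L \<longleftrightarrow> (\<forall>c d r. L (\<lambda>i. c i + r * d i) = L c + r * L d)"

lemma lin_funD: "lin_fun L \<Longrightarrow> L (\<lambda>i. c i + r * d i) = L c + r * L d"
  by (simp add: lin_fun_def)

lemma lin_fun_zero: "lin_fun L \<Longrightarrow> L (\<lambda>i. 0) = 0"
  using lin_funD[of L "\<lambda>i. 0" 1 "\<lambda>i. 0"] by simp

text \<open>Induction on the support: a new direction is made orthogonal to the old ones.\<close>

lemma riesz_finite_support:
  fixes B :: "('i \<Rightarrow> real) \<Rightarrow> ('i \<Rightarrow> real) \<Rightarrow> real"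
  assumes "finite J" "lin_fun L"
    and lin: "\<And>c. lin_fun (B c)"
    and sym: "\<And>c d. B c d = B d c"
    and null: "\<And>c d. B c c = 0 \<Longrightarrow> B c d = 0" "\<And>c. B c c = 0 \<Longrightarrow> L c = 0"
  shows "\<exists>c. (\<forall>i. i \<notin> J \<longrightarrow> c i = 0) \<and> (\<forall>d. (\<forall>i. i \<notin> J \<longrightarrow> d i = 0) \<longrightarrow> B c d = L d)"
  using assms(1,2) null(2)
proof (induction J arbitrary: L)
  case empty
  have "B (\<lambda>i. 0) d = L d" if "\<forall>i. i \<notin> {} \<longrightarrow> d i = 0" for d :: "'i \<Rightarrow> real"
  proof -
    have "d = (\<lambda>i. 0)" using that by auto
    then show ?thesis using lin_fun_zero[OF lin] lin_fun_zero[OF empty(1)] by simp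
  qed
  then show ?case by (intro exI[of _ "\<lambda>i. 0"]) auto
next
  case (insert j J)
  define e where "e i = (if i = j then 1 else 0 :: real)" for i
  have null': "B e c = 0" if "B c c = 0" for c
    using null(1)[OF that] sym by metis
  \<comment> \<open>The induction hypothesis for the functional \<open>B e\<close> yields the
    projection of e on the old coordinates.\<close>
  obtain r where r: "\<forall>i. i \<notin> J \<longrightarrow> r i = 0" "\<And>d. (\<forall>i. i \<notin> J \<longrightarrow> d i = 0) \<Longrightarrow> B r d = B e d"
    using insert.IH[of "B e"] lin null' by blast
  obtain q where q: "\<forall>i. i \<notin> J \<longrightarrow> q i = 0" "\<And>d. (\<forall>i. i \<notin> J \<longrightarrow> d i = 0) \<Longrightarrow> B q d = L d"
    using insert.IH[of L] insert.prems by blast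
  define e' where "e' i = e i + (- 1) * r i" for i
  have e'_orth: "B e' d = 0" if "\<forall>i. i \<notin> J \<longrightarrow> d i = 0" for d :: "'i \<Rightarrow> real"
    using lin_funD[OF lin, of d e "- 1" r] r(2)[OF that] sym by (simp add: e'_def[abs_def])
  \<comment> \<open>Forced by the equation at \<open>e'\<close>. If \<open>B e' e' = 0\<close>,
    division by zero makes m zero, which is right because \<open>L\<close> and \<open>B q\<close>
    vanish on null vectors.\<close>
  define m where "m = (L e' - B q e') / B e' e'"
  define c where "c i = q i + m * e' i" for i
  have B_c: "B c d = B q d + m * B e' d" for d
    using lin_funD[OF lin, of d q m e'] by (simp add: sym[of _ d] c_def[abs_def])
  have m: "B q e' + m * B e' e' = L e'"
  proof (cases "B e' e' = 0")
    case True
    then have "L e' = 0" "B q e' = 0"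
      using insert.prems(2) null(1) sym by metis+
    then show ?thesis using True by simp
  qed (simp add: m_def)
  show ?case
  proof (intro exI[of _ c] conjI allI impI)
    fix i assume "i \<notin> insert j J"
    then show "c i = 0"
      using q(1) r(1) by (simp add: c_def e'_def e_def)
  next
    fix d :: "'i \<Rightarrow> real"
    assume d: "\<forall>i. i \<notin> insert j J \<longrightarrow> d i = 0"
    \<comment> \<open>Since j is not in J, r vanishes at j and e' has entry 1 there; the subtraction
      removes the j-th entry of d.\<close>
    define d' where "d' i = d i + (- d j) * e' i" for i
    have d': "\<forall>i. i \<notin> J \<longrightarrow> d' i = 0"
      using d r(1) insert.hyps(2) by (auto simp: d'_def e'_def e_def)
    have d_eq: "d = (\<lambda>i. d' i + d j * e' i)"
      by (simp add: d'_def)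
    have "B c d' = L d'"
      using q(2)[OF d'] e'_orth[OF d'] by (simp add: B_c)
    moreover have "B c e' = L e'"
      using m by (simp add: B_c)
    ultimately show "B c d = L d"
      using lin_funD[OF lin, of c d' "d j" e'] lin_funD[OF insert.prems(1), of d' "d j" e']
      by (simp add: d_eq[symmetric])
  qed
qed

section \<open>Polynomials\<close>

definition multi_indices :: "nat \<Rightarrow> ('a::euclidean_space \<Rightarrow> nat) set" where
  "multi_indices k = {\<alpha>. \<alpha> \<in> Basis \<rightarrow>\<^sub>E (UNIV :: nat set) \<and> (\<Sum>b\<in>Basis. \<alpha> b) \<le> k}"

definition monomial_fun :: "('a::euclidean_space \<Rightarrow> nat) \<Rightarrow> 'a \<Rightarrow> real" where
  "monomial_fun \<alpha> x = (\<Prod>b\<in>Basis. (x \<bullet> b) ^ \<alpha> b)"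

lemma Poly_iff: "f \<in> Poly k \<longleftrightarrow> (\<exists>c. f = (\<lambda>x. \<Sum>\<alpha>\<in>multi_indices k. c \<alpha> * monomial_fun \<alpha> x))"
  by (auto simp: Poly_def multi_indices_def monomial_fun_def)

lemma finite_multi_indices: "finite (multi_indices k :: ('a::euclidean_space \<Rightarrow> nat) set)"
proof (rule finite_subset)
  show "(multi_indices k :: ('a \<Rightarrow> nat) set) \<subseteq> Basis \<rightarrow>\<^sub>E {..k}"
  proof
    fix \<alpha> :: "'a \<Rightarrow> nat" assume \<alpha>: "\<alpha> \<in> multi_indices k"
    then have "\<alpha> b \<le> k" if "b \<in> Basis" for b
      using member_le_sum[of b Basis \<alpha>] that by (simp add: multi_indices_def)
    then show "\<alpha> \<in> Basis \<rightarrow>\<^sub>E {..k}"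
      using \<alpha> by (auto simp: multi_indices_def)
  qed
  show "finite (Basis \<rightarrow>\<^sub>E {..k} :: ('a \<Rightarrow> nat) set)"
    by (intro finite_PiE) auto
qed

lemma Poly_comb:
  assumes "f \<in> Poly k" "g \<in> Poly k"
  shows "(\<lambda>x. f x + t * g x) \<in> Poly k"
proof -
  obtain c d where "f = (\<lambda>x. \<Sum>\<alpha>\<in>multi_indices k. c \<alpha> * monomial_fun \<alpha> x)"
      "g = (\<lambda>x. \<Sum>\<alpha>\<in>multi_indices k. d \<alpha> * monomial_fun \<alpha> x)"
    using assms unfolding Poly_iff by blast
  then have "(\<lambda>x. f x + t * g x) = (\<lambda>x. \<Sum>\<alpha>\<in>multi_indices k. (\<lambda>\<alpha>. c \<alpha> + t * d \<alpha>) \<alpha> * monomial_fun \<alpha> x)"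
    by (simp add: sum.distrib sum_distrib_left distrib_right mult.assoc)
  then show ?thesis
    unfolding Poly_iff by (intro exI[of _ "\<lambda>\<alpha>. c \<alpha> + t * d \<alpha>"])
qed

text \<open>As \<open>grad\<close> is a definite description, existence of a derivative has to be
  carried through sums and products; continuity of the gradient makes it measurable and bounded on
  elements.\<close>

definition C1_fun :: "('a::euclidean_space \<Rightarrow> real) \<Rightarrow> bool" where
  "C1_fun f \<longleftrightarrow> (\<exists>g. continuous_on UNIV g \<and> (\<forall>x. GDERIV f x :> g x))"

lemma GDERIV_imp_grad:
  assumes "GDERIV f x :> D"
  shows "grad f x = D"
  unfolding grad_def
proof (rule the_equality, rule assms)
  fix D' assume "GDERIV f x :> D'"
  then have "(\<lambda>h. h \<bullet> D) = (\<lambda>h. h \<bullet> D')"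
    using assms unfolding gderiv_def by (rule has_derivative_unique[rotated])
  then show "D' = D"
    by (metis vector_eq_ldot)
qed

lemma C1_funD:
  assumes "C1_fun f"
  shows "GDERIV f x :> grad f x" "continuous_on UNIV (grad f)" "continuous_on UNIV f"
proof -
  obtain g where g: "continuous_on UNIV g" "\<And>x. GDERIV f x :> g x"
    using assms by (auto simp: C1_fun_def)
  then have "grad f = g"
    using GDERIV_imp_grad by fastforce
  with g show "GDERIV f x :> grad f x" "continuous_on UNIV (grad f)" by auto
  show "continuous_on UNIV f"
    using g(2) unfolding gderiv_def
    by (intro continuous_at_imp_continuous_on ballI) (auto intro: has_derivative_continuous)
qed

lemma C1_fun_const: "C1_fun (\<lambda>x. c)"
  unfolding C1_fun_def using GDERIV_const by (intro exI[of _ "\<lambda>x. 0"]) auto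

lemma C1_fun_coord: "C1_fun (\<lambda>x. x \<bullet> b)"
  unfolding C1_fun_def gderiv_def
  by (intro exI[of _ "\<lambda>x. b"]) (auto intro: bounded_linear_imp_has_derivative bounded_linear_inner_left)

lemma C1_fun_add: "C1_fun f \<Longrightarrow> C1_fun g \<Longrightarrow> C1_fun (\<lambda>x. f x + g x)"
  unfolding C1_fun_def by (blast intro: GDERIV_add continuous_on_add)

lemma C1_fun_mult:
  assumes "C1_fun f" "C1_fun g"
  shows "C1_fun (\<lambda>x. f x * g x)"
  unfolding C1_fun_def
proof (intro exI conjI allI)
  show "continuous_on UNIV (\<lambda>x. f x *\<^sub>R grad g x + g x *\<^sub>R grad f x)"
    using assms by (intro continuous_intros C1_funD)
  show "GDERIV (\<lambda>x. f x * g x) x :> f x *\<^sub>R grad g x + g x *\<^sub>R grad f x" for x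
    using assms by (intro GDERIV_mult C1_funD)
qed

lemma C1_fun_power: "C1_fun f \<Longrightarrow> C1_fun (\<lambda>x. f x ^ n)"
  by (induction n) (auto intro: C1_fun_const C1_fun_mult)

lemma C1_fun_sum: "(\<And>i. i \<in> I \<Longrightarrow> C1_fun (f i)) \<Longrightarrow> C1_fun (\<lambda>x. \<Sum>i\<in>I. f i x)"
  by (induction I rule: infinite_finite_induct) (auto intro: C1_fun_const C1_fun_add)

lemma C1_fun_prod: "(\<And>i. i \<in> I \<Longrightarrow> C1_fun (f i)) \<Longrightarrow> C1_fun (\<lambda>x. \<Prod>i\<in>I. f i x)"
  by (induction I rule: infinite_finite_induct) (auto intro: C1_fun_const C1_fun_mult)

lemma C1_fun_Poly: "f \<in> Poly k \<Longrightarrow> C1_fun f"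
  unfolding Poly_iff monomial_fun_def
  by (auto intro!: C1_fun_sum C1_fun_mult C1_fun_prod C1_fun_power C1_fun_const C1_fun_coord)

lemma continuous_Poly: "f \<in> Poly k \<Longrightarrow> continuous_on UNIV f"
  by (intro C1_funD C1_fun_Poly)

lemma grad_comb:
  assumes "C1_fun f" "C1_fun g"
  shows "grad (\<lambda>x. f x + t * g x) x = grad f x + t *\<^sub>R grad g x"
  using GDERIV_add[OF C1_funD(1)[OF assms(1)]
      GDERIV_mult[OF GDERIV_const[of t] C1_funD(1)[OF assms(2)]]]
  by (intro GDERIV_imp_grad) simp

section \<open>Identity theorem for polynomials\<close>

lemma Poly_on_line:
  assumes "f \<in> Poly k"
  shows "\<exists>P. \<forall>t. f (a + t *\<^sub>R v) = poly P t"
proof -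
  obtain c where f: "f = (\<lambda>x. \<Sum>\<alpha>\<in>multi_indices k. c \<alpha> * monomial_fun \<alpha> x)"
    using assms unfolding Poly_iff by blast
  have "f (a + t *\<^sub>R v) =
      poly (\<Sum>\<alpha>\<in>multi_indices k. smult (c \<alpha>) (\<Prod>b\<in>Basis. [:a \<bullet> b, v \<bullet> b:] ^ \<alpha> b)) t" for t
    by (simp add: f monomial_fun_def poly_sum poly_prod inner_add_left)
  then show ?thesis by blast
qed

text \<open>On the line from a point of \<open>S\<close> to x, the polynomial becomes univariate
  with a whole interval of zeros near t = 0, so it is the zero polynomial; t = 1 is the point
  x.\<close>

lemma Poly_eq_zero:
  assumes "f \<in> Poly k" "open S" "S \<noteq> {}" "\<And>x. x \<in> S \<Longrightarrow> f x = 0"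
  shows "f x = 0"
proof -
  obtain a where a: "a \<in> S" using assms(3) by blast
  obtain P where P: "\<And>t. f (a + t *\<^sub>R (x - a)) = poly P t"
    using Poly_on_line[OF assms(1)] by blast
  have "((\<lambda>t. a + t *\<^sub>R (x - a)) \<longlongrightarrow> a + 0 *\<^sub>R (x - a)) (at_right 0)"
    by (intro tendsto_intros)
  then have "\<forall>\<^sub>F t in at_right 0. a + t *\<^sub>R (x - a) \<in> S"
    using a assms(2) by (intro topological_tendstoD) auto
  then obtain \<epsilon> :: real where \<epsilon>: "0 < \<epsilon>" "\<And>t. 0 < t \<Longrightarrow> t < \<epsilon> \<Longrightarrow> a + t *\<^sub>R (x - a) \<in> S"
    unfolding eventually_at_right_field by auto
  then have "{0<..<\<epsilon>} \<subseteq> {t. poly P t = 0}"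
    using assms(4) P by fastforce
  then have "P = 0"
    using poly_roots_finite[of P] infinite_Ioo[OF \<epsilon>(1)] finite_subset by blast
  then show ?thesis
    using P[of 1] by simp
qed

section \<open>Measures on the domain and on faces\<close>

abbreviation face_space :: "'a::euclidean_space set \<Rightarrow> 'a measure" where
  "face_space e \<equiv> restrict_space (face_measure e) e"

lemma measurable_restrict_completion:
  assumes "f \<in> borel_measurable borel" "sets M = sets borel"
  shows "f \<in> borel_measurable (restrict_space (completion M) S)"
  using assms
  by (intro measurable_restrict_space1 measurable_completion) (simp cong: measurable_cong_sets)

lemma set_integral_restrict:
  fixes f :: "'x \<Rightarrow> 'b::{banach, second_countable_topology}"
  assumes "S \<in> sets M"
  shows "(LINT x:S|M. f x) = (LINT x|restrict_space M S. f x)"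
  using assms
  by (subst integral_restrict_space) (auto simp: set_lebesgue_integral_def sets.Int_space_eq2)

lemma Lp_on_imp_Lp_fun:
  assumes "Lp_on p M S f" "S \<in> sets M"
  shows "Lp_fun p (restrict_space M S) f"
  using assms
  by (auto simp: Lp_fun_def Lp_on_def set_borel_measurable_def set_integrable_def
      borel_measurable_restrict_space_iff integrable_restrict_space sets.Int_space_eq2)

text \<open>Shows that the choice in \<open>tangent_basis\<close> has a witness: the differences of
  points of the hull are the hull translated by one of its points, hence a subspace, which has an
  orthonormal basis.\<close>

lemma tangent_basis_props:
  assumes "e \<noteq> {}"
  shows "pairwise orthogonal (tangent_basis e) \<and> (\<forall>b\<in>tangent_basis e. norm b = 1) \<and>
    span (tangent_basis e) = {x - y | x y. x \<in> affine hull e \<and> y \<in> affine hull e}"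
proof -
  define S where "S = {x - y | x y. x \<in> affine hull e \<and> y \<in> affine hull e}"
  obtain a where a: "a \<in> affine hull e"
    using assms by (metis all_not_in_conv hull_inc)
  have "S = (\<lambda>x. x - a) ` (affine hull e)"
  proof (intro subset_antisym subsetI)
    fix z assume "z \<in> S"
    then obtain x y where xy: "x \<in> affine hull e" "y \<in> affine hull e" "z = x - y"
      by (auto simp: S_def)
    \<comment> \<open>An affine combination, the weights 1, -1 and 1 adding up to 1.\<close>
    have "1 *\<^sub>R x + (- 1) *\<^sub>R y + 1 *\<^sub>R a \<in> affine hull e"
      using xy a by (intro mem_affine_3 affine_affine_hull) auto
    then show "z \<in> (\<lambda>x. x - a) ` (affine hull e)"
      using xy by (intro image_eqI[of _ _ "x - y + a"]) auto
  qed (use a S_def in auto)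
  then have "subspace S"
    using affine_diffs_subspace_subtract[OF affine_affine_hull a] by simp
  then obtain B where "pairwise orthogonal B" "\<And>x. x \<in> B \<Longrightarrow> norm x = 1" "span B = S"
    using orthonormal_basis_subspace by metis
  then have "pairwise orthogonal B \<and> (\<forall>b\<in>B. norm b = 1) \<and> span B = S"
    by blast
  from someI[of "\<lambda>B. pairwise orthogonal B \<and> (\<forall>b\<in>B. norm b = 1) \<and> span B = S", OF this]
  show ?thesis
    unfolding tangent_basis_def S_def .
qed

lemma finite_tangent_basis: "e \<noteq> {} \<Longrightarrow> finite (tangent_basis e)"
proof -
  assume "e \<noteq> {}"
  note B = tangent_basis_props[OF this]
  then have "0 \<notin> tangent_basis e"
    by auto
  with B have "independent (tangent_basis e)"
    by (intro pairwise_orthogonal_independent) auto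
  then show ?thesis
    by (rule independent_imp_finite)
qed

definition face_chart :: "'a::euclidean_space set \<Rightarrow> ('a \<Rightarrow> real) \<Rightarrow> 'a" where
  "face_chart e t = (SOME a. a \<in> e) + (\<Sum>b\<in>tangent_basis e. t b *\<^sub>R b)"

lemma face_measure_eq:
  "face_measure e = completion (distr (\<Pi>\<^sub>M b\<in>tangent_basis e. lborel) borel (face_chart e))"
  by (simp add: face_measure_def face_chart_def[abs_def])

lemma face_chart_measurable: "face_chart e \<in> (\<Pi>\<^sub>M b\<in>tangent_basis e. lborel) \<rightarrow>\<^sub>M borel"
  unfolding face_chart_def[abs_def] by measurable

lemma compact_in_face_measure: "compact e \<Longrightarrow> e \<in> sets (face_measure e)"
  by (simp add: face_measure_eq borel_compact)

text \<open>In the orthonormal coordinates, a bounded set lies in a box.\<close>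

lemma finite_face_measure:
  assumes "compact e" "e \<noteq> {}"
  shows "finite_measure (face_space e)"
proof -
  define M where "M = (\<Pi>\<^sub>M b\<in>tangent_basis e. lborel :: real measure)"
  define a where "a = (SOME a. a \<in> e)"
  note B = tangent_basis_props[OF assms(2)] and fin = finite_tangent_basis[OF assms(2)]
  obtain R where R: "\<And>x. x \<in> e \<Longrightarrow> norm (x - a) \<le> R"
    using bounded_translation_minus[OF compact_imp_bounded[OF assms(1)], of a]
    by (auto simp: bounded_iff)
  interpret product_sigma_finite "\<lambda>_. lborel :: real measure" ..
  \<comment> \<open>By orthonormality a coordinate is an inner product with a unit vector, so R
    bounds it on e.\<close>
  have coord: "t b = (face_chart e t - a) \<bullet> b" if "b \<in> tangent_basis e" for t b
  proof -
    have "(\<Sum>b'\<in>tangent_basis e. t b' *\<^sub>R b') \<bullet> b = (\<Sum>b'\<in>tangent_basis e. if b' = b then t b else 0)"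
      unfolding inner_sum_left
      using B that
      by (intro sum.cong) (auto simp: pairwise_def orthogonal_def dot_square_norm)
    then show ?thesis
      using fin that by (simp add: face_chart_def a_def)
  qed
  have "face_chart e -` e \<inter> space M \<subseteq> tangent_basis e \<rightarrow>\<^sub>E {-R..R}"
  proof
    fix t assume t: "t \<in> face_chart e -` e \<inter> space M"
    have "\<bar>t b\<bar> \<le> R" if "b \<in> tangent_basis e" for b
      using Cauchy_Schwarz_ineq2[of "face_chart e t - a" b] R[of "face_chart e t"] t B that
      by (auto simp: coord[OF that, symmetric])
    then show "t \<in> tangent_basis e \<rightarrow>\<^sub>E {-R..R}"
      using t by (auto simp: M_def space_PiM PiE_iff abs_le_iff) (smt (verit))
  qed
  then have "emeasure M (face_chart e -` e \<inter> space M) \<le> emeasure M (tangent_basis e \<rightarrow>\<^sub>E {-R..R})"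
    unfolding M_def using fin by (intro emeasure_mono sets_PiM_I_finite) auto
  also have "\<dots> = (\<Prod>b\<in>tangent_basis e. emeasure lborel {-R..R})"
    unfolding M_def using fin by (intro emeasure_PiM) auto
  also have "\<dots> < \<infinity>"
    by (auto simp: ennreal_prod_eq_top less_top[symmetric] emeasure_lborel_Icc_eq power_eq_top_ennreal
        zero_power2 power_0_left)
  finally have "emeasure (face_measure e) e < \<infinity>"
    using assms face_chart_measurable[of e]
    by (simp add: face_measure_eq main_part_sets borel_compact emeasure_distr M_def)
  then show ?thesis
    using compact_in_face_measure[OF assms(1)]
    by (intro finite_measureI)
      (simp add: emeasure_restrict_space space_restrict_space sets.Int_space_eq2)
qed

section \<open>Pairings and norms as integrals over restricted measures\<close>

lemma face_pair_eq:
  assumes "\<And>e. e \<in> E \<Longrightarrow> compact e"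
  shows "face_pair E u w = (\<Sum>e\<in>E. LINT x|face_space e. u e x \<bullet> w e x)"
  unfolding face_pair_def using assms
  by (intro sum.cong refl set_integral_restrict compact_in_face_measure) auto

text \<open>The p-th power undoes the p-th root only on a nonnegative base, which is where the sign
  of the weights enters.\<close>

lemma face_Lp_norm_powr:
  assumes "0 < p" "\<And>e. e \<in> E \<Longrightarrow> compact e" "\<And>e. e \<in> E \<Longrightarrow> 0 \<le> w e"
  shows "face_Lp_norm p E w u powr p = (\<Sum>e\<in>E. w e * p_energy p (face_space e) (u e))"
proof -
  define s where "s = (\<Sum>e\<in>E. LINT x:e|face_measure e. norm (u e x) powr p * w e)"
  have s: "s = (\<Sum>e\<in>E. w e * p_energy p (face_space e) (u e))"
    unfolding s_def p_energy_def using assms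
    by (intro sum.cong refl) (simp add: set_integral_restrict compact_in_face_measure)
  also have "\<dots> \<ge> 0"
    using assms by (intro sum_nonneg mult_nonneg_nonneg) (auto simp: p_energy_def)
  finally show ?thesis
    using assms(1) unfolding s[symmetric] face_Lp_norm_def s_def[symmetric] by (simp add: powr_powr)
qed

lemma dom_pair_eq:
  assumes "open \<Omega>"
  shows "dom_pair \<Omega> u w = (LINT x|lebesgue_on \<Omega>. u x \<bullet> w x)"
  unfolding dom_pair_def using assms by (intro set_integral_restrict) auto

lemma dom_Lp_norm_powr:
  assumes "0 < p" "open \<Omega>"
  shows "dom_Lp_norm p \<Omega> u powr p = p_energy p (lebesgue_on \<Omega>) u"
proof -
  have "0 \<le> p_energy p (lebesgue_on \<Omega>) u"
    by (simp add: p_energy_def)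
  then show ?thesis
    unfolding dom_Lp_norm_def using assms
    by (simp add: set_integral_restrict p_energy_def powr_powr)
qed

lemma bdd_meas_face:
  fixes f :: "'a::euclidean_space \<Rightarrow> 'b::euclidean_space"
  assumes "compact e" "continuous_on UNIV f"
  shows "bdd_meas (face_space e) f"
proof -
  have "bounded (f ` e)"
    using assms by (meson compact_continuous_image compact_imp_bounded continuous_on_subset top_greatest)
  then have "\<exists>C. \<forall>x\<in>space (face_space e). norm (f x) \<le> C"
    by (auto simp: space_restrict_space bounded_iff)
  moreover have "f \<in> borel_measurable (face_space e)"
    unfolding face_measure_eq
    using assms by (intro measurable_restrict_completion borel_measurable_continuous_onI) auto
  ultimately show ?thesis
    by (simp add: bdd_meas_def)
qed

section \<open>The mesh\<close>

locale dg_mesh =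
  fixes \<Omega> :: "'a::euclidean_space set" and T :: "'a set set"
  assumes dom: "polyhedral_domain \<Omega>" and mesh: "simplicial_mesh \<Omega> T"
begin

lemma open_dom: "open \<Omega>" and bounded_dom: "bounded \<Omega>"
  using dom by (auto simp: polyhedral_domain_def)

text \<open>A finite union of polytopes is closed, so it contains the closure of the domain, and its
  interior is the domain again.\<close>

lemma interior_closure_dom: "interior (closure \<Omega>) = \<Omega>"
proof -
  obtain P where P: "finite P" "\<forall>Q\<in>P. polytope Q" "\<Omega> = interior (\<Union>P)"
    using dom by (auto simp: polyhedral_domain_def)
  then have "closed (\<Union>P)"
    by (intro closed_Union) (auto intro: polytope_imp_closed)
  then have "closure \<Omega> \<subseteq> \<Union>P"
    using P by (simp add: closure_minimal interior_subset)
  then have "interior (closure \<Omega>) \<subseteq> \<Omega>"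
    using P by (simp add: interior_mono)
  then show ?thesis
    using open_dom by (simp add: closure_subset interior_maximal subset_antisym)
qed

lemma finite_mesh: "finite T" and Union_mesh: "\<Union>T = closure \<Omega>"
  using mesh by (auto simp: simplicial_mesh_def)

lemma elem_polytope: "K \<in> T \<Longrightarrow> polytope K"
  using mesh by (auto simp: simplicial_mesh_def intro: simplex_imp_polytope)

lemma elem_compact: "K \<in> T \<Longrightarrow> compact K" and elem_convex: "K \<in> T \<Longrightarrow> convex K"
  using elem_polytope by (auto intro: polytope_imp_compact polytope_imp_convex)

lemma elem_interior:
  assumes "K \<in> T"
  shows "interior K \<noteq> {}"
proof -
  have "aff_dim K = int DIM('a)"
    using mesh assms by (auto simp: simplicial_mesh_def intro: aff_dim_simplex)
  then have "affine hull K = UNIV" "K \<noteq> {}"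
    by (auto simp: aff_dim_eq_full)
  then show ?thesis
    using elem_convex[OF assms] rel_interior_interior rel_interior_eq_empty by metis
qed

text \<open>Provides the open set on which a broken polynomial is tested in
  \<open>dom_pair_definite\<close>. An open set that meets the closure of a set meets the
  set.\<close>

lemma elem_interior_meets_dom:
  assumes "K \<in> T"
  shows "interior K \<inter> \<Omega> \<noteq> {}"
proof -
  have "interior K \<inter> closure \<Omega> \<noteq> {}"
    using elem_interior[OF assms] Union_mesh assms interior_subset by blast
  then show ?thesis
    by (metis open_Int_closure_eq_empty open_interior)
qed

lemma interior_face_compact:
  assumes "e \<in> interior_faces T"
  shows "compact e" "e \<noteq> {}"
proof -
  obtain K1 K2 where e: "e = K1 \<inter> K2" "K1 \<in> T" "K2 \<in> T" "aff_dim e = int DIM('a) - 1"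
    using assms by (auto simp: interior_faces_def)
  then show "compact e"
    by (auto intro: elem_compact compact_Int)
  show "e \<noteq> {}"
    \<comment> \<open>The empty set has affine dimension -1, while d - 1 is nonnegative.\<close>
    using e(4) DIM_positive[where 'a = 'a] by (intro notI) simp
qed

lemma boundary_face:
  assumes "e \<in> boundary_faces \<Omega> T"
  shows "compact e" "e \<noteq> {}" "convex e" "bd_elem T e \<in> T" "e \<subseteq> bd_elem T e" "e \<subseteq> frontier \<Omega>"
proof -
  obtain K where K: "K \<in> T" "e facet_of K"
    using assms by (auto simp: boundary_faces_def)
  then have "e face_of K" "e \<subseteq> K"
    by (auto simp: facet_of_imp_face_of facet_of_imp_subset)
  then show "compact e" "convex e"
    using face_of_polytope_polytope[OF elem_polytope[OF K(1)]]
    by (simp_all add: polytope_imp_compact polytope_imp_convex)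
  show "e \<noteq> {}" using K(2) by (simp add: facet_of_def)
  have "bd_elem T e \<in> adjacent T e"
    unfolding bd_elem_def using K(1) \<open>e \<subseteq> K\<close>
    by (intro someI[of "\<lambda>K. K \<in> adjacent T e" K]) (simp add: adjacent_def)
  then show "bd_elem T e \<in> T" "e \<subseteq> bd_elem T e"
    by (auto simp: adjacent_def)
  show "e \<subseteq> frontier \<Omega>"
    using assms by (simp add: boundary_faces_def)
qed

text \<open>The interior of an element lies in \<open>\<Omega>\<close>, since \<open>\<Omega>\<close> is the interior of its closure; hence a
  boundary face does not meet it, and a separating hyperplane exists.\<close>

lemma norm_bd_normal:
  assumes "e \<in> boundary_faces \<Omega> T"
  shows "norm (bd_normal T e) = 1"
proof -
  define K where "K = bd_elem T e"
  note e = boundary_face[OF assms, folded K_def]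
  have "interior K \<subseteq> \<Omega>"
    using interior_mono[of K "closure \<Omega>"] Union_mesh e(4) interior_closure_dom by auto
  then have "interior K \<inter> e = {}"
    using e(6) open_dom by (auto simp: frontier_def interior_open)
  then obtain a b where ab: "a \<noteq> 0" "\<And>x. x \<in> interior K \<Longrightarrow> a \<bullet> x \<le> b" "\<And>x. x \<in> e \<Longrightarrow> b \<le> a \<bullet> x"
    using separating_hyperplane_sets[of "interior K" e] e elem_interior elem_convex
      convex_interior by metis
  \<comment> \<open>Separation speaks of the interior only. Its closure is K, and as e lies in K
    both inequalities hold on e, which makes the hyperplane contain e.\<close>
  have "closure (interior K) \<subseteq> {x. a \<bullet> x \<le> b}"
    using ab(2) by (intro closure_minimal closed_halfspace_le) auto
  moreover have "closure (interior K) = K"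
    using convex_closure_interior[OF elem_convex[OF e(4)] elem_interior[OF e(4)]]
      elem_compact[OF e(4)] by (simp add: compact_imp_closed)
  ultimately have le: "\<And>x. x \<in> K \<Longrightarrow> a \<bullet> x \<le> b" and eq: "\<And>x. x \<in> e \<Longrightarrow> a \<bullet> x = b"
    using ab(3) e(5) by (auto intro!: antisym)
  define n where "n = a /\<^sub>R norm a"
  have "norm n = 1 \<and> (\<exists>c. (\<forall>x\<in>e. n \<bullet> x = c) \<and> (\<forall>x\<in>K. n \<bullet> x \<le> c))"
    using ab(1) le eq
    by (auto simp: n_def divide_inverse mult.commute intro!: exI[of _ "b / norm a"] mult_left_mono)
  from someI[of "\<lambda>n. norm n = 1 \<and> (\<exists>c. (\<forall>x\<in>e. n \<bullet> x = c) \<and> (\<forall>x\<in>K. n \<bullet> x \<le> c))", OF this]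
  show ?thesis
    by (simp add: bd_normal_def outward_normal_def K_def)
qed

sublocale dom: finite_measure "lebesgue_on \<Omega>"
  using bounded_dom open_dom
  by (intro finite_measure_lebesgue_on) (simp add: bounded_set_imp_lmeasurable)

lemma bdd_meas_pw:
  fixes q :: "'a set \<Rightarrow> 'a \<Rightarrow> 'b::euclidean_space"
  assumes "\<And>K. K \<in> T \<Longrightarrow> continuous_on UNIV (q K)"
  shows "bdd_meas (lebesgue_on \<Omega>) (pw T q)"
proof -
  \<comment> \<open>A sum over the fixed finite set \<open>T\<close> instead of one that depends on
    x shows measurability and the bound.\<close>
  have eq: "pw T q x = (\<Sum>K\<in>T. indicator (interior K) x *\<^sub>R q K x)" for x
  proof -
    have "(\<Sum>K\<in>T. indicator (interior K) x *\<^sub>R q K x) = (\<Sum>K\<in>T. if x \<in> interior K then q K x else 0)"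
      by (intro sum.cong) (auto simp: indicator_def)
    then show ?thesis
      using finite_mesh by (simp add: pw_def sum.inter_filter)
  qed
  have "\<exists>C. \<forall>x\<in>K. norm (q K x) \<le> C" if "K \<in> T" for K
    using compact_imp_bounded[OF compact_continuous_image[OF
        continuous_on_subset[OF assms[OF that] subset_UNIV] elem_compact[OF that]]]
    by (auto simp: bounded_iff)
  then obtain C where C: "\<And>K x. K \<in> T \<Longrightarrow> x \<in> K \<Longrightarrow> norm (q K x) \<le> C K"
    by metis
  have "norm (pw T q x) \<le> (\<Sum>K\<in>T. \<bar>C K\<bar>)" for x
    unfolding eq using C interior_subset
    by (intro order.trans[OF norm_sum] sum_mono) (fastforce simp: indicator_def)
  moreover have "pw T q \<in> borel_measurable (lebesgue_on \<Omega>)"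
  proof (rule measurable_restrict_completion)
    have "q K \<in> borel_measurable borel" if "K \<in> T" for K
      using assms[OF that] by (rule borel_measurable_continuous_onI)
    then show "pw T q \<in> borel_measurable borel"
      unfolding eq[abs_def] by (intro borel_measurable_sum borel_measurable_scaleR borel_measurable_indicator) auto
  qed simp
  ultimately show ?thesis
    unfolding bdd_meas_def by blast
qed

lemma pw_elem:
  assumes "K \<in> T" "x \<in> interior K"
  shows "pw T q x = q K x"
proof -
  have "{K' \<in> T. x \<in> interior K'} = {K}"
  proof (intro subset_antisym subsetI)
    fix K' assume K': "K' \<in> {K' \<in> T. x \<in> interior K'}"
    have "pairwise (\<lambda>K K'. interior K \<inter> interior K' = {}) T"
      using mesh by (simp add: simplicial_mesh_def)
    then have "K' = K"
      using K' assms by (auto simp: pairwise_def disjoint_iff)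
    then show "K' \<in> {K}" by simp
  qed (use assms in auto)
  then show ?thesis
    by (simp add: pw_def)
qed

end

section \<open>Linear combinations of broken functions\<close>

text \<open>\<open>V_h\<close> and \<open>Q_h\<close> consist of extensional families, undefined off
  \<open>T\<close>. Pointwise operations need not respect this, hence the restriction.\<close>

definition comb :: "'a::euclidean_space set set \<Rightarrow> ('a set \<Rightarrow> 'a \<Rightarrow> 'b::real_vector) \<Rightarrow> real \<Rightarrow>
    ('a set \<Rightarrow> 'a \<Rightarrow> 'b) \<Rightarrow> 'a set \<Rightarrow> 'a \<Rightarrow> 'b" where
  "comb T u t v = restrict (\<lambda>K x. u K x + t *\<^sub>R v K x) T"

lemma comb_elem: "K \<in> T \<Longrightarrow> comb T u t v K = (\<lambda>x. u K x + t *\<^sub>R v K x)"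
  by (simp add: comb_def)

lemma comb_V_h: "u \<in> V_h k T \<Longrightarrow> v \<in> V_h k T \<Longrightarrow> comb T u t v \<in> V_h k T"
  by (auto simp: V_h_def comb_def PiE_iff Poly_comb)

lemma comb_Q_h: "q \<in> Q_h k T \<Longrightarrow> r \<in> Q_h k T \<Longrightarrow> comb T q t r \<in> Q_h k T"
  by (auto simp: Q_h_def comb_def PiE_iff inner_add_left Poly_comb)

lemma V_h_ext: "u \<in> V_h k T \<Longrightarrow> v \<in> V_h k T \<Longrightarrow> (\<And>K. K \<in> T \<Longrightarrow> u K = v K) \<Longrightarrow> u = v"
  unfolding V_h_def by (rule PiE_ext)

lemma Q_h_ext: "q \<in> Q_h k T \<Longrightarrow> r \<in> Q_h k T \<Longrightarrow> (\<And>K. K \<in> T \<Longrightarrow> q K = r K) \<Longrightarrow> q = r"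
  unfolding Q_h_def by (rule PiE_ext)

lemma V_h_Poly: "v \<in> V_h k T \<Longrightarrow> K \<in> T \<Longrightarrow> v K \<in> Poly k"
  by (auto simp: V_h_def)

lemma Q_h_Poly: "q \<in> Q_h k T \<Longrightarrow> K \<in> T \<Longrightarrow> b \<in> Basis \<Longrightarrow> (\<lambda>x. q K x \<bullet> b) \<in> Poly k"
  by (auto simp: Q_h_def PiE_iff)

lemma continuous_V_h: "v \<in> V_h k T \<Longrightarrow> K \<in> T \<Longrightarrow> continuous_on UNIV (v K)"
  by (intro continuous_Poly V_h_Poly)

lemma continuous_Q_h: "q \<in> Q_h k T \<Longrightarrow> K \<in> T \<Longrightarrow> continuous_on UNIV (q K)"
  by (subst continuous_on_componentwise) (auto intro: continuous_Poly Q_h_Poly)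

lemma pw_comb: "pw T (comb T u t v) x = pw T u x + t *\<^sub>R pw T v x"
  by (simp add: pw_def comb_elem sum.distrib scaleR_sum_right)

lemma pw_broken_grad_comb:
  assumes "u \<in> V_h k T" "v \<in> V_h k T"
  shows "pw T (broken_grad (comb T u t v)) x = pw T (broken_grad u) x + t *\<^sub>R pw T (broken_grad v) x"
  using C1_fun_Poly[OF V_h_Poly[OF assms(1)]] C1_fun_Poly[OF V_h_Poly[OF assms(2)]]
  by (simp add: pw_def broken_grad_def comb_elem grad_comb sum.distrib scaleR_sum_right)

lemma jump_comb: "jump T (comb T u t v) e x = jump T u e x + t *\<^sub>R jump T v e x"
  by (simp add: jump_def adjacent_def comb_elem scaleR_add_left sum.distrib scaleR_sum_right)

lemma njump_comb: "njump T (comb T q t r) e x = njump T q e x + t * njump T r e x"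
  by (simp add: njump_def adjacent_def comb_elem inner_add_left sum.distrib sum_distrib_left)

lemma avg_comb: "avg T (comb T q t r) e x = avg T q e x + t *\<^sub>R avg T r e x"
proof -
  have "(\<Sum>K\<in>adjacent T e. comb T q t r K x) =
      (\<Sum>K\<in>adjacent T e. q K x) + t *\<^sub>R (\<Sum>K\<in>adjacent T e. r K x)"
    by (simp add: adjacent_def comb_elem sum.distrib scaleR_sum_right)
  then show ?thesis
    by (simp add: avg_def scaleR_add_right)
qed

lemma integral_comb:
  fixes f g :: "'x \<Rightarrow> real"
  assumes "integrable M f" "integrable M g"
  shows "(LINT x|M. f x + t * g x) = (LINT x|M. f x) + t * (LINT x|M. g x)"
  using assms by simp

lemma continuous_jump:
  assumes "\<And>K. K \<in> T \<Longrightarrow> continuous_on UNIV (v K)"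
  shows "continuous_on UNIV (jump T v e)"
  unfolding jump_def[abs_def] using assms by (intro continuous_intros) (auto simp: adjacent_def)

lemma continuous_flux:
  assumes "\<And>K. K \<in> T \<Longrightarrow> continuous_on UNIV (q K)"
  shows "continuous_on UNIV (\<lambda>x. avg T q e x - njump T q e x *\<^sub>R c)"
  unfolding avg_def njump_def using assms by (intro continuous_intros) (auto simp: adjacent_def)

section \<open>The inner product on broken fields and its definiteness\<close>

context dg_mesh
begin

lemma bdd_meas_Q_h: "q \<in> Q_h k T \<Longrightarrow> bdd_meas (lebesgue_on \<Omega>) (pw T q)"
  and bdd_meas_V_h: "v \<in> V_h k T \<Longrightarrow> bdd_meas (lebesgue_on \<Omega>) (pw T v)"
  by (auto intro!: bdd_meas_pw continuous_Q_h continuous_V_h)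

lemma bdd_meas_broken_grad: "v \<in> V_h k T \<Longrightarrow> bdd_meas (lebesgue_on \<Omega>) (pw T (broken_grad v))"
  unfolding broken_grad_def by (intro bdd_meas_pw C1_funD(2) C1_fun_Poly V_h_Poly)

lemma dom_pair_comb_right:
  assumes "bdd_meas (lebesgue_on \<Omega>) b" "bdd_meas (lebesgue_on \<Omega>) c" "integrable (lebesgue_on \<Omega>) a"
  shows "dom_pair \<Omega> a (\<lambda>x. b x + t *\<^sub>R c x) = dom_pair \<Omega> a b + t * dom_pair \<Omega> a c"
  using assms by (simp add: dom_pair_eq open_dom inner_add_right bdd_meas_inner_integrable)

lemma dom_pair_commute: "dom_pair \<Omega> a b = dom_pair \<Omega> b a"
  by (simp add: dom_pair_def inner_commute)

lemma dom_pair_pw_comb: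
  assumes "q \<in> Q_h k T" "r \<in> Q_h k T" "bdd_meas (lebesgue_on \<Omega>) a"
  shows "dom_pair \<Omega> a (pw T (comb T q t r)) = dom_pair \<Omega> a (pw T q) + t * dom_pair \<Omega> a (pw T r)"
  unfolding pw_comb[abs_def] using assms
  by (intro dom_pair_comb_right bdd_meas_Q_h dom.bdd_meas_integrable)

text \<open>A vanishing integral gives zero almost everywhere, continuity gives zero on the open set
  where the element meets \<Omega>, and the identity theorem gives zero on the whole space. The last
  is needed because equality in \<open>Q_h\<close> is equality of polynomials everywhere.\<close>

lemma dom_pair_definite:
  assumes q: "q \<in> Q_h k T" and 0: "dom_pair \<Omega> (pw T q) (pw T q) = 0" and K: "K \<in> T"
  shows "q K x = 0"
proof -
  have "integrable (lebesgue_on \<Omega>) (\<lambda>x. pw T q x \<bullet> pw T q x)"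
    using q by (intro bdd_meas_inner_integrable bdd_meas_Q_h dom.bdd_meas_integrable)
  then have "AE x in lebesgue_on \<Omega>. pw T q x = 0"
    using 0 integral_nonneg_eq_0_iff_AE[of "lebesgue_on \<Omega>" "\<lambda>x. pw T q x \<bullet> pw T q x"]
    by (simp add: dom_pair_eq open_dom)
  then have ae: "AE x in lebesgue. x \<in> \<Omega> \<longrightarrow> pw T q x = 0"
    using open_dom by (subst (asm) AE_restrict_space_iff) auto
  have "q K x \<bullet> b = 0" if b: "b \<in> Basis" for b
  proof (rule Poly_eq_zero[OF Q_h_Poly[OF q K b]])
    show "open (interior K \<inter> \<Omega>)" "interior K \<inter> \<Omega> \<noteq> {}"
      using open_dom elem_interior_meets_dom[OF K] by auto
    fix y assume y: "y \<in> interior K \<inter> \<Omega>"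
    have "y \<in> {y. q K y \<bullet> b = 0}"
    proof (rule mem_closed_if_AE_lebesgue_open)
      show "closed {y. q K y \<bullet> b = 0}"
        using continuous_Poly[OF Q_h_Poly[OF q K b]]
        by (intro closed_Collect_eq continuous_on_const)
      show "AE y \<in> interior K \<inter> \<Omega> in lebesgue. y \<in> {y. q K y \<bullet> b = 0}"
        using ae by eventually_elim (auto simp: pw_elem[OF K])
    qed (use y open_dom in auto)
    then show "q K y \<bullet> b = 0" by simp
  qed
  then show ?thesis
    by (metis euclidean_eqI inner_zero_left)
qed

text \<open>Coordinates on \<open>Q_h\<close>, indexed by element, component and exponent.\<close>

definition Q_fun :: "nat \<Rightarrow> ('a set \<times> 'a \<times> ('a \<Rightarrow> nat) \<Rightarrow> real) \<Rightarrow> 'a set \<Rightarrow> 'a \<Rightarrow> 'a" where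
  "Q_fun k c = restrict (\<lambda>K x. \<Sum>b\<in>Basis.
     (\<Sum>\<alpha>\<in>multi_indices k. c (K, b, \<alpha>) * monomial_fun \<alpha> x) *\<^sub>R b) T"

lemma Q_fun_comb: "Q_fun k (\<lambda>i. c i + t * d i) = comb T (Q_fun k c) t (Q_fun k d)"
  by (auto simp: Q_fun_def comb_def fun_eq_iff distrib_right sum.distrib scaleR_add_left
      scaleR_sum_right sum_distrib_left mult.assoc)

lemma Q_fun_in_Q_h: "Q_fun k c \<in> Q_h k T"
proof -
  have "(\<lambda>x. \<Sum>\<alpha>\<in>multi_indices k. c (K, b, \<alpha>) * monomial_fun \<alpha> x) \<in> Poly k" for K and b :: 'a
    unfolding Poly_iff by (intro exI[of _ "\<lambda>\<alpha>. c (K, b, \<alpha>)"]) simp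
  then show ?thesis
    by (auto simp: Q_h_def Q_fun_def inner_sum_left_Basis)
qed

lemma Q_h_eq_Q_fun:
  assumes "q \<in> Q_h k T"
  shows "\<exists>c. q = Q_fun k c \<and> (\<forall>i. i \<notin> T \<times> Basis \<times> multi_indices k \<longrightarrow> c i = 0)"
proof -
  have "\<forall>K b. \<exists>c. K \<in> T \<longrightarrow> b \<in> Basis \<longrightarrow>
      (\<lambda>x. q K x \<bullet> b) = (\<lambda>x. \<Sum>\<alpha>\<in>multi_indices k. c \<alpha> * monomial_fun \<alpha> x)"
    using Q_h_Poly[OF assms] unfolding Poly_iff by blast
  then obtain c where c: "\<And>K b. K \<in> T \<Longrightarrow> b \<in> Basis \<Longrightarrow>
      (\<lambda>x. q K x \<bullet> b) = (\<lambda>x. \<Sum>\<alpha>\<in>multi_indices k. c K b \<alpha> * monomial_fun \<alpha> x)"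
    by metis
  define d where "d i = (if i \<in> T \<times> Basis \<times> multi_indices k
    then (case i of (K, b, \<alpha>) \<Rightarrow> c K b \<alpha>) else 0)" for i
  have "q K = Q_fun k d K" if K: "K \<in> T" for K
  proof
    fix x
    have "q K x = (\<Sum>b\<in>Basis. (q K x \<bullet> b) *\<^sub>R b)"
      by (simp add: euclidean_representation)
    also have "\<dots> = Q_fun k d K x"
      using K fun_cong[OF c[OF K]] by (simp add: Q_fun_def d_def)
    finally show "q K x = Q_fun k d K x" .
  qed
  moreover have "q K = Q_fun k d K" if "K \<notin> T" for K
    using that assms by (auto simp: Q_h_def Q_fun_def PiE_iff extensional_def)
  ultimately have "q = Q_fun k d"
    by blast
  then show ?thesis
    by (intro exI[of _ d]) (simp add: d_def)
qed

text \<open>Existence is pulled back to coefficients. Distinct families may give the same field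
  there, so the form is only semidefinite, and its null vectors are exactly the families of the zero
  field, on which \<open>l\<close> vanishes. Uniqueness comes from testing the difference of two
  solutions with itself.\<close>

lemma Q_h_riesz:
  assumes lin: "\<And>q r t. q \<in> Q_h k T \<Longrightarrow> r \<in> Q_h k T \<Longrightarrow> l (comb T q t r) = l q + t * l r"
  shows "\<exists>!q. q \<in> Q_h k T \<and> (\<forall>\<zeta>\<in>Q_h k T. dom_pair \<Omega> (pw T q) (pw T \<zeta>) = l \<zeta>)"
proof -
  define B where "B c d = dom_pair \<Omega> (pw T (Q_fun k c)) (pw T (Q_fun k d))" for c d
  define z :: "'a set \<Rightarrow> 'a \<Rightarrow> 'a" where "z = restrict (\<lambda>K x. 0) T"
  have z: "z \<in> Q_h k T"
    using Q_fun_in_Q_h[of k "\<lambda>i. 0"] by (simp add: z_def Q_fun_def)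
  \<comment> \<open>Linearity turns this into \<open>l z = l z + l z\<close>.\<close>
  have "comb T z 1 z = z"
    by (auto simp: comb_def z_def)
  then have l_z: "l z = 0"
    using lin[OF z z, of 1] by simp
  have B_null: "Q_fun k c = z" if "B c c = 0" for c
  proof (intro ext)
    fix K x
    show "Q_fun k c K x = z K x"
    proof (cases "K \<in> T")
      case True
      then show ?thesis
        using dom_pair_definite[OF Q_fun_in_Q_h that[unfolded B_def]] by (simp add: z_def)
    qed (simp add: z_def Q_fun_def)
  qed
  have "\<exists>c. (\<forall>i. i \<notin> T \<times> Basis \<times> multi_indices k \<longrightarrow> c i = 0) \<and>
      (\<forall>d. (\<forall>i. i \<notin> T \<times> Basis \<times> multi_indices k \<longrightarrow> d i = 0) \<longrightarrow> B c d = l (Q_fun k d))"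
  proof (rule riesz_finite_support)
    show "finite (T \<times> Basis \<times> multi_indices k)"
      by (intro finite_cartesian_product finite_mesh finite_multi_indices finite_Basis)
    show "lin_fun (\<lambda>c. l (Q_fun k c))"
      by (simp add: lin_fun_def Q_fun_comb lin Q_fun_in_Q_h)
    show "lin_fun (B c)" for c
      by (simp add: lin_fun_def B_def Q_fun_comb dom_pair_pw_comb[where k = k] Q_fun_in_Q_h
          bdd_meas_Q_h[where k = k])
    show "B c d = B d c" for c d
      by (simp add: B_def dom_pair_commute)
    show "B c d = 0" if "B c c = 0" for c d
      using B_null[OF that] by (simp add: B_def z_def pw_def dom_pair_def)
    show "l (Q_fun k c) = 0" if "B c c = 0" for c
      using B_null[OF that] l_z by simp
  qed
  then obtain c where "\<And>d. (\<forall>i. i \<notin> T \<times> Basis \<times> multi_indices k \<longrightarrow> d i = 0) \<Longrightarrow> B c d = l (Q_fun k d)"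
    by blast
  then have c: "dom_pair \<Omega> (pw T (Q_fun k c)) (pw T \<zeta>) = l \<zeta>" if "\<zeta> \<in> Q_h k T" for \<zeta>
    using Q_h_eq_Q_fun[OF that] unfolding B_def by metis
  show ?thesis
  proof (intro ex1I[of _ "Q_fun k c"] conjI ballI Q_fun_in_Q_h c)
    fix q assume q: "q \<in> Q_h k T \<and> (\<forall>\<zeta>\<in>Q_h k T. dom_pair \<Omega> (pw T q) (pw T \<zeta>) = l \<zeta>)"
    define r where "r = comb T q (- 1) (Q_fun k c)"
    have r: "r \<in> Q_h k T"
      using q by (simp add: r_def comb_Q_h Q_fun_in_Q_h)
    have "dom_pair \<Omega> (pw T r) (pw T r) =
        dom_pair \<Omega> (pw T q) (pw T r) - dom_pair \<Omega> (pw T (Q_fun k c)) (pw T r)"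
      using dom_pair_pw_comb[OF conjunct1[OF q] Q_fun_in_Q_h bdd_meas_Q_h[OF r], of "- 1" c]
        dom_pair_commute[of "pw T r" "pw T q"] dom_pair_commute[of "pw T r" "pw T (Q_fun k c)"]
      by (simp add: r_def[symmetric])
    also have "\<dots> = 0"
      using q r c by simp
    finally have "\<And>K x. K \<in> T \<Longrightarrow> r K x = 0"
      by (rule dom_pair_definite[OF r])
    then have "\<And>K. K \<in> T \<Longrightarrow> q K = Q_fun k c K"
      by (auto simp: r_def comb_elem fun_eq_iff)
    then show "q = Q_fun k c"
      by (rule Q_h_ext[OF conjunct1[OF q] Q_fun_in_Q_h])
  qed auto
qed

end

section \<open>The discrete gradient and the energy\<close>

locale dg_problem = dg_mesh \<Omega> T
  for \<Omega> :: "'a::euclidean_space set" and T :: "'a set set" +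
  fixes p :: real and k :: nat and \<Gamma>D \<Gamma>N :: "'a set" and h \<eta> :: "'a set \<Rightarrow> real"
    and C12 :: "'a set \<Rightarrow> 'a" and f gD :: "'a \<Rightarrow> real" and gN :: "'a \<Rightarrow> 'a"
  assumes p: "1 < p"
    and weights: "\<And>e. e \<in> interior_faces T \<union> boundary_faces \<Omega> T \<Longrightarrow> 0 < h e \<and> 0 < \<eta> e"
    and f_integrable: "integrable (lebesgue_on \<Omega>) f"
    and gD_Lp: "\<And>e. e \<in> faces_in \<Omega> T \<Gamma>D \<Longrightarrow> Lp_fun p (face_space e) gD"
    and gN_integrable: "\<And>e. e \<in> faces_in \<Omega> T \<Gamma>N \<Longrightarrow> integrable (face_space e) (\<lambda>x. gN x \<bullet> bd_normal T e)"
begin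

lemma faces_in_boundary: "e \<in> faces_in \<Omega> T \<Gamma> \<Longrightarrow> e \<in> boundary_faces \<Omega> T"
  by (simp add: faces_in_def)

lemma bd_face: "e \<in> faces_in \<Omega> T \<Gamma> \<Longrightarrow> compact e" "e \<in> faces_in \<Omega> T \<Gamma> \<Longrightarrow> bd_elem T e \<in> T"
  by (auto dest: faces_in_boundary boundary_face)

lemma finite_face_space:
  "e \<in> interior_faces T \<Longrightarrow> finite_measure (face_space e)"
  "e \<in> faces_in \<Omega> T \<Gamma> \<Longrightarrow> finite_measure (face_space e)"
  by (auto intro!: finite_face_measure dest: interior_face_compact faces_in_boundary boundary_face)

lemma bdd_meas_jump: "v \<in> V_h k T \<Longrightarrow> e \<in> interior_faces T \<Longrightarrow> bdd_meas (face_space e) (jump T v e)"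
  by (intro bdd_meas_face interior_face_compact continuous_jump continuous_V_h)

lemma bdd_meas_flux:
  "q \<in> Q_h k T \<Longrightarrow> e \<in> interior_faces T \<Longrightarrow>
    bdd_meas (face_space e) (\<lambda>x. avg T q e x - njump T q e x *\<^sub>R C12 e)"
  by (intro bdd_meas_face interior_face_compact continuous_flux continuous_Q_h)

lemma bdd_meas_trace:
  "v \<in> V_h k T \<Longrightarrow> e \<in> faces_in \<Omega> T \<Gamma> \<Longrightarrow> bdd_meas (face_space e) (bd_trace T v e)"
  unfolding bd_trace_def by (rule bdd_meas_face[OF bd_face(1) continuous_V_h[OF _ bd_face(2)]])

lemma bdd_meas_normal_trace:
  "q \<in> Q_h k T \<Longrightarrow> e \<in> faces_in \<Omega> T \<Gamma> \<Longrightarrow>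
    bdd_meas (face_space e) (\<lambda>x. bd_trace T q e x \<bullet> bd_normal T e)"
  unfolding bd_trace_def
  by (intro bdd_meas_face[OF bd_face(1)] continuous_on_inner continuous_on_const
      continuous_Q_h[OF _ bd_face(2)])

lemma trace_comb:
  "e \<in> faces_in \<Omega> T \<Gamma> \<Longrightarrow> bd_trace T (comb T u t v) e x = bd_trace T u e x + t *\<^sub>R bd_trace T v e x"
  by (simp add: bd_trace_def comb_elem bd_face)

definition grad_rhs :: "('a set \<Rightarrow> 'a \<Rightarrow> real) \<Rightarrow> ('a \<Rightarrow> real) \<Rightarrow> ('a set \<Rightarrow> 'a \<Rightarrow> 'a) \<Rightarrow> real" where
  "grad_rhs v g \<zeta> = dom_pair \<Omega> (pw T (broken_grad v)) (pw T \<zeta>)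
     - face_pair (interior_faces T) (jump T v) (\<lambda>e x. avg T \<zeta> e x - njump T \<zeta> e x *\<^sub>R C12 e)
     - face_pair (faces_in \<Omega> T \<Gamma>D) (\<lambda>e x. bd_trace T v e x - g x)
         (\<lambda>e x. bd_trace T \<zeta> e x \<bullet> bd_normal T e)"

text \<open>The hypothesis concerns the products of the integrands and not one fixed factor, so that
  it covers linearity in the test field as well as affinity in the broken function and its
  datum.\<close>

lemma face_pair_comb:
  fixes U V W :: "'a set \<Rightarrow> 'a \<Rightarrow> 'b::euclidean_space"
  assumes "\<And>e. e \<in> E \<Longrightarrow> compact e"
    and "\<And>e. e \<in> E \<Longrightarrow> integrable (face_space e) (\<lambda>x. U1 e x \<bullet> W1 e x)"
    and "\<And>e. e \<in> E \<Longrightarrow> integrable (face_space e) (\<lambda>x. U2 e x \<bullet> W2 e x)"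
    and "\<And>e x. e \<in> E \<Longrightarrow> U e x \<bullet> W e x = U1 e x \<bullet> W1 e x + t * (U2 e x \<bullet> W2 e x)"
  shows "face_pair E U W = face_pair E U1 W1 + t * face_pair E U2 W2"
  using assms by (simp add: face_pair_eq integral_comb sum.distrib sum_distrib_left)

lemma dirichlet_integrable:
  assumes "v \<in> V_h k T" "e \<in> faces_in \<Omega> T \<Gamma>D" "integrable (face_space e) g"
  shows "integrable (face_space e) (\<lambda>x. bd_trace T v e x - g x)"
  using finite_measure.bdd_meas_integrable[OF finite_face_space(2) bdd_meas_trace, OF assms(2,1,2)]
    assms(3) by (rule Bochner_Integration.integrable_diff)

lemma grad_rhs_comb_test:
  assumes "v \<in> V_h k T" "q \<in> Q_h k T" "r \<in> Q_h k T"
    and g: "\<And>e. e \<in> faces_in \<Omega> T \<Gamma>D \<Longrightarrow> integrable (face_space e) g"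
  shows "grad_rhs v g (comb T q t r) = grad_rhs v g q + t * grad_rhs v g r"
proof -
  have "face_pair (interior_faces T) (jump T v)
        (\<lambda>e x. avg T (comb T q t r) e x - njump T (comb T q t r) e x *\<^sub>R C12 e) =
      face_pair (interior_faces T) (jump T v) (\<lambda>e x. avg T q e x - njump T q e x *\<^sub>R C12 e) +
      t * face_pair (interior_faces T) (jump T v) (\<lambda>e x. avg T r e x - njump T r e x *\<^sub>R C12 e)"
    using assms finite_face_space
    by (intro face_pair_comb bdd_meas_inner_integrable bdd_meas_jump interior_face_compact
        finite_measure.bdd_meas_integrable bdd_meas_flux)
      (auto simp: avg_comb njump_comb algebra_simps)
  moreover have "face_pair (faces_in \<Omega> T \<Gamma>D) (\<lambda>e x. bd_trace T v e x - g x)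
        (\<lambda>e x. bd_trace T (comb T q t r) e x \<bullet> bd_normal T e) =
      face_pair (faces_in \<Omega> T \<Gamma>D) (\<lambda>e x. bd_trace T v e x - g x)
        (\<lambda>e x. bd_trace T q e x \<bullet> bd_normal T e) +
      t * face_pair (faces_in \<Omega> T \<Gamma>D) (\<lambda>e x. bd_trace T v e x - g x)
        (\<lambda>e x. bd_trace T r e x \<bullet> bd_normal T e)"
    using assms
    by (intro face_pair_comb bdd_meas_inner_integrable(2) bdd_meas_normal_trace
        dirichlet_integrable g) (auto simp: bd_face trace_comb inner_add_left algebra_simps)
  moreover have "dom_pair \<Omega> (pw T (broken_grad v)) (pw T (comb T q t r)) =
      dom_pair \<Omega> (pw T (broken_grad v)) (pw T q) + t * dom_pair \<Omega> (pw T (broken_grad v)) (pw T r)"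
    using assms by (intro dom_pair_pw_comb bdd_meas_broken_grad)
  ultimately show ?thesis
    by (simp add: grad_rhs_def algebra_simps)
qed

text \<open>The datum stays with \<open>u\<close> while the direction \<open>v\<close> gets the
  datum 0; this is where the discrete gradient \<open>D_DG(v;0)\<close> of the weak form
  originates.\<close>

lemma grad_rhs_comb:
  assumes "u \<in> V_h k T" "v \<in> V_h k T" "q \<in> Q_h k T"
    and g: "\<And>e. e \<in> faces_in \<Omega> T \<Gamma>D \<Longrightarrow> integrable (face_space e) g"
  shows "grad_rhs (comb T u t v) g q = grad_rhs u g q + t * grad_rhs v (\<lambda>x. 0) q"
proof -
  have "face_pair (interior_faces T) (jump T (comb T u t v)) (\<lambda>e x. avg T q e x - njump T q e x *\<^sub>R C12 e) =
      face_pair (interior_faces T) (jump T u) (\<lambda>e x. avg T q e x - njump T q e x *\<^sub>R C12 e) +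
      t * face_pair (interior_faces T) (jump T v) (\<lambda>e x. avg T q e x - njump T q e x *\<^sub>R C12 e)"
    using assms finite_face_space
    by (intro face_pair_comb bdd_meas_inner_integrable bdd_meas_jump interior_face_compact
        finite_measure.bdd_meas_integrable bdd_meas_flux)
      (auto simp: jump_comb inner_add_left)
  moreover have "face_pair (faces_in \<Omega> T \<Gamma>D) (\<lambda>e x. bd_trace T (comb T u t v) e x - g x)
        (\<lambda>e x. bd_trace T q e x \<bullet> bd_normal T e) =
      face_pair (faces_in \<Omega> T \<Gamma>D) (\<lambda>e x. bd_trace T u e x - g x)
        (\<lambda>e x. bd_trace T q e x \<bullet> bd_normal T e) +
      t * face_pair (faces_in \<Omega> T \<Gamma>D) (\<lambda>e x. bd_trace T v e x - 0)
        (\<lambda>e x. bd_trace T q e x \<bullet> bd_normal T e)"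
    using assms
    by (intro face_pair_comb bdd_meas_inner_integrable(2) bdd_meas_normal_trace
        dirichlet_integrable g) (auto simp: bd_face trace_comb algebra_simps)
  \<comment> \<open>The factors are swapped since \<open>dom_pair_comb_right\<close> expands the
    second argument.\<close>
  moreover have "dom_pair \<Omega> (pw T q) (pw T (broken_grad (comb T u t v))) =
      dom_pair \<Omega> (pw T q) (pw T (broken_grad u)) + t * dom_pair \<Omega> (pw T q) (pw T (broken_grad v))"
    unfolding pw_broken_grad_comb[OF assms(1,2), abs_def] using assms
    by (intro dom_pair_comb_right bdd_meas_broken_grad dom.bdd_meas_integrable bdd_meas_Q_h)
  ultimately show ?thesis
    by (simp add: grad_rhs_def dom_pair_commute[of _ "pw T q"] algebra_simps)
qed

abbreviation "DG \<equiv> D_DG k \<Omega> \<Gamma>D T C12"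

lemma D_DG_unique:
  assumes "v \<in> V_h k T" "\<And>e. e \<in> faces_in \<Omega> T \<Gamma>D \<Longrightarrow> integrable (face_space e) g"
  shows "\<exists>!q. q \<in> Q_h k T \<and> (\<forall>\<zeta>\<in>Q_h k T. dom_pair \<Omega> (pw T q) (pw T \<zeta>) = grad_rhs v g \<zeta>)"
  using assms by (intro Q_h_riesz grad_rhs_comb_test)

lemma D_DG_eq: "DG v g =
    (THE q. q \<in> Q_h k T \<and> (\<forall>\<zeta>\<in>Q_h k T. dom_pair \<Omega> (pw T q) (pw T \<zeta>) = grad_rhs v g \<zeta>))"
  unfolding D_DG_def grad_rhs_def ..

lemma D_DG_props:
  assumes "v \<in> V_h k T" "\<And>e. e \<in> faces_in \<Omega> T \<Gamma>D \<Longrightarrow> integrable (face_space e) g"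
  shows "DG v g \<in> Q_h k T"
    and "\<zeta> \<in> Q_h k T \<Longrightarrow> dom_pair \<Omega> (pw T (DG v g)) (pw T \<zeta>) = grad_rhs v g \<zeta>"
  using theI'[OF D_DG_unique[OF assms]] unfolding D_DG_eq by auto

lemma gD_integrable: "e \<in> faces_in \<Omega> T \<Gamma>D \<Longrightarrow> integrable (face_space e) gD"
  using finite_measure.Lp_fun_integrable[OF finite_face_space(2) gD_Lp] p by simp

lemma D_DG_comb:
  assumes "u \<in> V_h k T" "v \<in> V_h k T"
  shows "DG (comb T u t v) gD = comb T (DG u gD) t (DG v (\<lambda>x. 0))"
  unfolding D_DG_eq[of "comb T u t v"]
proof (rule the1_equality[OF D_DG_unique], intro comb_V_h assms)
  note Du = D_DG_props[OF assms(1) gD_integrable]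
  have Dv: "DG v (\<lambda>x. 0) \<in> Q_h k T"
      "\<And>\<zeta>. \<zeta> \<in> Q_h k T \<Longrightarrow> dom_pair \<Omega> (pw T (DG v (\<lambda>x. 0))) (pw T \<zeta>) = grad_rhs v (\<lambda>x. 0) \<zeta>"
    using D_DG_props[OF assms(2), of "\<lambda>x. 0"] by auto
  show "comb T (DG u gD) t (DG v (\<lambda>x. 0)) \<in> Q_h k T \<and>
      (\<forall>\<zeta>\<in>Q_h k T. dom_pair \<Omega> (pw T (comb T (DG u gD) t (DG v (\<lambda>x. 0)))) (pw T \<zeta>) =
        grad_rhs (comb T u t v) gD \<zeta>)"
  proof (intro conjI ballI)
    fix \<zeta> assume \<zeta>: "\<zeta> \<in> Q_h k T"
    have "dom_pair \<Omega> (pw T (comb T (DG u gD) t (DG v (\<lambda>x. 0)))) (pw T \<zeta>) =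
        dom_pair \<Omega> (pw T (DG u gD)) (pw T \<zeta>) + t * dom_pair \<Omega> (pw T (DG v (\<lambda>x. 0))) (pw T \<zeta>)"
      using dom_pair_pw_comb[OF Du(1) Dv(1) bdd_meas_Q_h[OF \<zeta>]] dom_pair_commute[of "pw T \<zeta>"]
      by simp
    also have "\<dots> = grad_rhs (comb T u t v) gD \<zeta>"
      using grad_rhs_comb[OF assms \<zeta> gD_integrable] Du(2)[OF _ \<zeta>] Dv(2)[OF \<zeta>] by simp
    finally show "dom_pair \<Omega> (pw T (comb T (DG u gD) t (DG v (\<lambda>x. 0)))) (pw T \<zeta>) =
        grad_rhs (comb T u t v) gD \<zeta>" .
  qed (use Du Dv in \<open>simp add: comb_Q_h\<close>)
qed (rule gD_integrable)

section \<open>The functional, its slope and the weak form\<close>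

definition weight :: "'a set \<Rightarrow> real" where
  "weight e = \<eta> e * h e powr (1 - p)"

lemma weight_nonneg: "e \<in> interior_faces T \<Longrightarrow> 0 \<le> weight e"
    "e \<in> faces_in \<Omega> T \<Gamma> \<Longrightarrow> 0 \<le> weight e"
  using weights[of e] by (auto simp: weight_def dest: faces_in_boundary)

definition load :: "('a set \<Rightarrow> 'a \<Rightarrow> real) \<Rightarrow> real" where
  "load v = dom_pair \<Omega> f (pw T v)
     + face_pair (faces_in \<Omega> T \<Gamma>N) (\<lambda>e x. gN x \<bullet> bd_normal T e) (bd_trace T v)"

definition slope :: "('a set \<Rightarrow> 'a \<Rightarrow> real) \<Rightarrow> ('a set \<Rightarrow> 'a \<Rightarrow> real) \<Rightarrow> real" where
  "slope u v = p_slope p (lebesgue_on \<Omega>) (pw T (DG u gD)) (pw T (DG v (\<lambda>x. 0)))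
     + (\<Sum>e\<in>interior_faces T. weight e * p_slope p (face_space e) (jump T u e) (jump T v e))
     + (\<Sum>e\<in>faces_in \<Omega> T \<Gamma>D. weight e *
          p_slope p (face_space e) (\<lambda>x. bd_trace T u e x - gD x) (bd_trace T v e))
     - load v"

abbreviation "J \<equiv> J_h p k \<Omega> \<Gamma>D \<Gamma>N T h \<eta> C12 f gD gN"

lemma load_comb:
  assumes "u \<in> V_h k T" "v \<in> V_h k T"
  shows "load (comb T u t v) = load u + t * load v"
proof -
  have "face_pair (faces_in \<Omega> T \<Gamma>N) (\<lambda>e x. gN x \<bullet> bd_normal T e) (bd_trace T (comb T u t v)) =
      face_pair (faces_in \<Omega> T \<Gamma>N) (\<lambda>e x. gN x \<bullet> bd_normal T e) (bd_trace T u) +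
      t * face_pair (faces_in \<Omega> T \<Gamma>N) (\<lambda>e x. gN x \<bullet> bd_normal T e) (bd_trace T v)"
    using assms
    by (intro face_pair_comb bdd_meas_inner_integrable(2) bdd_meas_trace gN_integrable)
      (auto simp: bd_face trace_comb algebra_simps)
  moreover have "dom_pair \<Omega> f (pw T (comb T u t v)) = dom_pair \<Omega> f (pw T u) + t * dom_pair \<Omega> f (pw T v)"
    unfolding pw_comb[abs_def] using assms by (intro dom_pair_comb_right bdd_meas_V_h f_integrable)
  ultimately show ?thesis
    by (simp add: load_def algebra_simps)
qed

text \<open>The factor 1/p is moved inside the sums so that each summand matches
  \<open>p_energy_subgradient\<close>.\<close>

lemma J_eq: "J v = 1 / p * p_energy p (lebesgue_on \<Omega>) (pw T (DG v gD))
    + (\<Sum>e\<in>interior_faces T. weight e * (1 / p * p_energy p (face_space e) (jump T v e)))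
    + (\<Sum>e\<in>faces_in \<Omega> T \<Gamma>D. weight e * (1 / p * p_energy p (face_space e) (\<lambda>x. bd_trace T v e x - gD x)))
    - load v"
proof -
  have "dom_Lp_norm p \<Omega> (pw T (DG v gD)) powr p = p_energy p (lebesgue_on \<Omega>) (pw T (DG v gD))"
    using p open_dom by (intro dom_Lp_norm_powr) auto
  moreover have "face_Lp_norm p (interior_faces T) (\<lambda>e. \<eta> e * h e powr (1 - p)) (jump T v) powr p =
      (\<Sum>e\<in>interior_faces T. weight e * p_energy p (face_space e) (jump T v e))"
    unfolding weight_def[symmetric] using p
    by (intro face_Lp_norm_powr interior_face_compact weight_nonneg) auto
  moreover have "face_Lp_norm p (faces_in \<Omega> T \<Gamma>D) (\<lambda>e. \<eta> e * h e powr (1 - p))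
        (\<lambda>e x. bd_trace T v e x - gD x) powr p =
      (\<Sum>e\<in>faces_in \<Omega> T \<Gamma>D. weight e * p_energy p (face_space e) (\<lambda>x. bd_trace T v e x - gD x))"
    unfolding weight_def[symmetric] using p
    by (intro face_Lp_norm_powr bd_face weight_nonneg) auto
  ultimately show ?thesis
    by (simp add: J_h_def load_def sum_divide_distrib)
qed

text \<open>\<open>A_p\<close> is homogeneous of degree p - 1, so the scaling by the inverse of
  \<open>h e\<close> inside it becomes the factor \<open>h e powr (1 - p)\<close> of the norms in
  the functional.\<close>

lemma weak_solution_iff:
  "weak_solution p k \<Omega> \<Gamma>D \<Gamma>N T h \<eta> C12 f gD gN u \<longleftrightarrow> u \<in> V_h k T \<and> (\<forall>v\<in>V_h k T. slope u v = 0)"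
proof -
  have h_powr: "\<eta> e * inverse (h e) powr (p - 1) = weight e"
    if "e \<in> interior_faces T \<union> boundary_faces \<Omega> T" for e
  proof -
    have "h e powr (1 - p) = inverse (h e) powr (p - 1)"
      using weights[OF that] powr_minus_divide[of "h e" "p - 1"]
      by (simp add: inverse_eq_divide powr_divide)
    then show ?thesis by (simp add: weight_def)
  qed
  have "dom_pair \<Omega> (\<lambda>x. A_p p (pw T (DG u gD) x)) (pw T (DG v (\<lambda>x. 0))) =
      p_slope p (lebesgue_on \<Omega>) (pw T (DG u gD)) (pw T (DG v (\<lambda>x. 0)))" for v
    by (simp add: dom_pair_eq open_dom p_slope_def)
  moreover have "face_pair (interior_faces T)
        (\<lambda>e x. \<eta> e *\<^sub>R A_p p (inverse (h e) *\<^sub>R jump T u e x)) (jump T v) =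
      (\<Sum>e\<in>interior_faces T. weight e * p_slope p (face_space e) (jump T u e) (jump T v e))" for v
  proof (subst face_pair_eq, erule interior_face_compact, intro sum.cong refl)
    fix e assume e: "e \<in> interior_faces T"
    have "\<eta> e *\<^sub>R A_p p (inverse (h e) *\<^sub>R jump T u e x) \<bullet> jump T v e x =
        weight e * (A_p p (jump T u e x) \<bullet> jump T v e x)" for x
      using weights[of e] h_powr[of e] e by (simp add: A_p_scaleR mult.assoc[symmetric])
    then show "(LINT x|face_space e. (\<eta> e *\<^sub>R A_p p (inverse (h e) *\<^sub>R jump T u e x)) \<bullet> jump T v e x) =
        weight e * p_slope p (face_space e) (jump T u e) (jump T v e)"
      by (simp add: p_slope_def)
  qed
  moreover have "face_pair (faces_in \<Omega> T \<Gamma>D)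
        (\<lambda>e x. \<eta> e *\<^sub>R A_p p ((inverse (h e) * (bd_trace T u e x - gD x)) *\<^sub>R bd_normal T e))
        (\<lambda>e x. bd_trace T v e x *\<^sub>R bd_normal T e) =
      (\<Sum>e\<in>faces_in \<Omega> T \<Gamma>D. weight e *
          p_slope p (face_space e) (\<lambda>x. bd_trace T u e x - gD x) (bd_trace T v e))" for v
  proof (subst face_pair_eq, erule bd_face, intro sum.cong refl)
    fix e assume "e \<in> faces_in \<Omega> T \<Gamma>D"
    then have e: "e \<in> boundary_faces \<Omega> T"
      by (rule faces_in_boundary)
    have n: "norm (bd_normal T e) = 1"
      using e by (rule norm_bd_normal)
    \<comment> \<open>The Dirichlet penalty is vectorial in the weak form and scalar in the
      functional; the unit normal leaves \<open>A_p\<close> and disappears because its square is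
      1.\<close>
    have "A_p p ((inverse (h e) * s) *\<^sub>R bd_normal T e) = (inverse (h e) powr (p - 1) * A_p p s) *\<^sub>R bd_normal T e" for s
      using weights[of e] e A_p_scaleR[of "inverse (h e)" p s] by (simp add: A_p_scaleR_unit[OF n])
    then have "(\<eta> e *\<^sub>R A_p p ((inverse (h e) * s) *\<^sub>R bd_normal T e)) \<bullet> (t *\<^sub>R bd_normal T e) =
        weight e * (A_p p s \<bullet> t)" for s t
      using h_powr[of e] e n by (simp add: dot_square_norm mult.assoc[symmetric])
    then show "(LINT x|face_space e.
          (\<eta> e *\<^sub>R A_p p ((inverse (h e) * (bd_trace T u e x - gD x)) *\<^sub>R bd_normal T e)) \<bullet>
          (bd_trace T v e x *\<^sub>R bd_normal T e)) =
        weight e * p_slope p (face_space e) (\<lambda>x. bd_trace T u e x - gD x) (bd_trace T v e)"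
      by (simp only: p_slope_def integral_mult_right_zero)
  qed
  ultimately show ?thesis
    by (simp add: weak_solution_def slope_def load_def diff_eq_eq)
qed

section \<open>Convexity, continuity of the slope, and minimizers\<close>

lemma Lp_fun_parts:
  assumes "v \<in> V_h k T"
  shows "Lp_fun p (lebesgue_on \<Omega>) (pw T (DG v gD))"
    and "Lp_fun p (lebesgue_on \<Omega>) (pw T (DG v (\<lambda>x. 0)))"
    and "e \<in> interior_faces T \<Longrightarrow> Lp_fun p (face_space e) (jump T v e)"
    and "e \<in> faces_in \<Omega> T \<Gamma>D \<Longrightarrow> Lp_fun p (face_space e) (bd_trace T v e)"
    and "e \<in> faces_in \<Omega> T \<Gamma>D \<Longrightarrow> Lp_fun p (face_space e) (\<lambda>x. bd_trace T v e x - gD x)"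
proof -
  show "Lp_fun p (lebesgue_on \<Omega>) (pw T (DG v gD))" "Lp_fun p (lebesgue_on \<Omega>) (pw T (DG v (\<lambda>x. 0)))"
    using assms p
    by (auto intro!: dom.bdd_meas_Lp_fun bdd_meas_Q_h[where k = k] D_DG_props(1) gD_integrable)
  show "Lp_fun p (face_space e) (jump T v e)" if "e \<in> interior_faces T"
    using assms p that by (intro finite_measure.bdd_meas_Lp_fun finite_face_space bdd_meas_jump) auto
  show tr: "Lp_fun p (face_space e) (bd_trace T v e)" if "e \<in> faces_in \<Omega> T \<Gamma>D"
    using assms p that by (intro finite_measure.bdd_meas_Lp_fun finite_face_space(2) bdd_meas_trace) auto
  show "Lp_fun p (face_space e) (\<lambda>x. bd_trace T v e x - gD x)" if "e \<in> faces_in \<Omega> T \<Gamma>D"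
    using Lp_fun_add[OF tr[OF that] Lp_fun_scaleR[OF gD_Lp[OF that], of "- 1"]] p by simp
qed

text \<open>Nonnegative weights preserve the inequality of each power term, and the load, being
  linear, contributes exactly -t \<open>load v\<close>. The sign of t is free, which the step back
  to a minimizer relies on.\<close>

lemma J_subgradient:
  assumes "u \<in> V_h k T" "v \<in> V_h k T"
  shows "J u + t * slope u v \<le> J (comb T u t v)"
proof -
  note parts = Lp_fun_parts[OF assms(1)] Lp_fun_parts[OF assms(2)]
  have "1 / p * p_energy p (lebesgue_on \<Omega>) (pw T (DG u gD))
      + t * p_slope p (lebesgue_on \<Omega>) (pw T (DG u gD)) (pw T (DG v (\<lambda>x. 0)))
      \<le> 1 / p * p_energy p (lebesgue_on \<Omega>) (pw T (DG (comb T u t v) gD))"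
    unfolding D_DG_comb[OF assms] pw_comb[abs_def] using p parts by (intro p_energy_subgradient)
  moreover have "(\<Sum>e\<in>interior_faces T. weight e * (1 / p * p_energy p (face_space e) (jump T u e)
        + t * p_slope p (face_space e) (jump T u e) (jump T v e)))
      \<le> (\<Sum>e\<in>interior_faces T. weight e * (1 / p * p_energy p (face_space e) (jump T (comb T u t v) e)))"
    unfolding jump_comb[abs_def] using p parts
    by (intro sum_mono mult_left_mono p_energy_subgradient weight_nonneg)
  moreover have "(\<Sum>e\<in>faces_in \<Omega> T \<Gamma>D. weight e * (1 / p * p_energy p (face_space e) (\<lambda>x. bd_trace T u e x - gD x)
        + t * p_slope p (face_space e) (\<lambda>x. bd_trace T u e x - gD x) (bd_trace T v e)))
      \<le> (\<Sum>e\<in>faces_in \<Omega> T \<Gamma>D. weight e *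
          (1 / p * p_energy p (face_space e) (\<lambda>x. bd_trace T (comb T u t v) e x - gD x)))"
  proof (intro sum_mono mult_left_mono)
    fix e assume e: "e \<in> faces_in \<Omega> T \<Gamma>D"
    \<comment> \<open>Regrouped so that the datum belongs to the base point and the direction is a
      pure trace.\<close>
    have "(\<lambda>x. bd_trace T (comb T u t v) e x - gD x) = (\<lambda>x. (bd_trace T u e x - gD x) + t *\<^sub>R bd_trace T v e x)"
      by (simp add: trace_comb[OF e] algebra_simps)
    then show "1 / p * p_energy p (face_space e) (\<lambda>x. bd_trace T u e x - gD x)
        + t * p_slope p (face_space e) (\<lambda>x. bd_trace T u e x - gD x) (bd_trace T v e)
        \<le> 1 / p * p_energy p (face_space e) (\<lambda>x. bd_trace T (comb T u t v) e x - gD x)"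
      using p_energy_subgradient[OF p parts(5)[OF e] parts(9)[OF e], of t] by simp
  qed (rule weight_nonneg)
  ultimately show ?thesis
    unfolding J_eq slope_def load_comb[OF assms]
    by (simp add: algebra_simps sum.distrib sum_distrib_left)
qed

lemma slope_tendsto:
  assumes "u \<in> V_h k T" "v \<in> V_h k T" "\<And>n. \<bar>s n\<bar> \<le> 1" "s \<longlonglongrightarrow> 0"
  shows "(\<lambda>n. slope (comb T u (s n) v) v) \<longlonglongrightarrow> slope u v"
proof -
  note parts = Lp_fun_parts[OF assms(1)] Lp_fun_parts[OF assms(2)]
  have "(\<lambda>n. p_slope p (face_space e) (\<lambda>x. bd_trace T (comb T u (s n) v) e x - gD x) (bd_trace T v e))
      \<longlonglongrightarrow> p_slope p (face_space e) (\<lambda>x. bd_trace T u e x - gD x) (bd_trace T v e)"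
    if e: "e \<in> faces_in \<Omega> T \<Gamma>D" for e
  proof -
    have "(\<lambda>x. bd_trace T (comb T u (s n) v) e x - gD x) =
        (\<lambda>x. (bd_trace T u e x - gD x) + s n *\<^sub>R bd_trace T v e x)" for n
      by (simp add: trace_comb[OF e] algebra_simps)
    then show ?thesis
      using p_slope_tendsto[OF p parts(5)[OF e] parts(9)[OF e] assms(3,4)] by simp
  qed
  then show ?thesis
    unfolding slope_def D_DG_comb[OF assms(1,2)] pw_comb[abs_def] jump_comb[abs_def]
    using p parts assms(3,4) by (intro tendsto_intros p_slope_tendsto)
qed

lemma minimizer_iff:
  "(u \<in> V_h k T \<and> (\<forall>v\<in>V_h k T. slope u v = 0)) \<longleftrightarrow> is_arg_min J (\<lambda>v. v \<in> V_h k T) u"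
proof
  assume u: "u \<in> V_h k T \<and> (\<forall>v\<in>V_h k T. slope u v = 0)"
  have "J u \<le> J w" if w: "w \<in> V_h k T" for w
  proof -
    \<comment> \<open>The direction w - u, so that the unit step from \<open>u\<close> ends at
      w.\<close>
    define v where "v = comb T w (- 1) u"
    have v: "v \<in> V_h k T"
      using u w by (simp add: v_def comb_V_h)
    have "comb T u 1 v = w"
      using comb_V_h[OF conjunct1[OF u] v] w by (rule V_h_ext) (simp add: comb_elem v_def)
    then show ?thesis
      using J_subgradient[OF conjunct1[OF u] v, of 1] u v by simp
  qed
  then show "is_arg_min J (\<lambda>v. v \<in> V_h k T) u"
    using u by (auto simp: is_arg_min_def not_less)
next
  assume "is_arg_min J (\<lambda>v. v \<in> V_h k T) u"
  then have u: "u \<in> V_h k T" and min: "\<And>w. w \<in> V_h k T \<Longrightarrow> J u \<le> J w"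
    by (auto simp: is_arg_min_def not_less)
  have "slope u v = 0" if v: "v \<in> V_h k T" for v
  proof -
    \<comment> \<open>From w = u + tv the step -t returns to u:
      \<open>J w - t * slope w v \<le> J u \<le> J w\<close>.\<close>
    have sgn: "0 \<le> t * slope (comb T u t v) v" for t
    proof -
      have w: "comb T u t v \<in> V_h k T"
        using u v by (rule comb_V_h)
      have "comb T (comb T u t v) (- t) v = u"
        using comb_V_h[OF w v] u by (rule V_h_ext) (simp add: comb_elem)
      then show ?thesis
        using J_subgradient[OF w v, of "- t"] min[OF w] by simp
    qed
    \<comment> \<open>Values in (0, 1], the range of the uniform bound; \<open>s\<close> and its
      negative approach 0 from both sides and yield the two inequalities.\<close>
    define s :: "nat \<Rightarrow> real" where "s n = inverse (real (Suc n))" for n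
    have s: "0 < s n" "\<bar>s n\<bar> \<le> 1" "\<bar>- s n\<bar> \<le> 1" for n
      by (auto simp: s_def field_simps)
    have s_lim: "s \<longlonglongrightarrow> 0"
      unfolding s_def[abs_def] by (rule LIMSEQ_inverse_real_of_nat)
    have "0 \<le> slope (comb T u (s n) v) v" "slope (comb T u (- s n) v) v \<le> 0" for n
      using sgn[of "s n"] sgn[of "- s n"] s(1)[of n] by (auto simp: zero_le_mult_iff mult_le_0_iff)
    then have "0 \<le> slope u v" "slope u v \<le> 0"
      using LIMSEQ_le_const[OF slope_tendsto[OF u v s(2) s_lim]]
        LIMSEQ_le_const2[OF slope_tendsto[OF u v s(3) tendsto_minus_cancel]] s_lim
      by (auto simp: tendsto_minus_cancel_left)
    then show ?thesis by simp
  qed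
  then show "u \<in> V_h k T \<and> (\<forall>v\<in>V_h k T. slope u v = 0)"
    using u by simp
qed

end

theorem theorem4p3:
  fixes \<Omega> \<Gamma>D \<Gamma>N :: "'a::euclidean_space set"
    and T :: "'a set set"
    and p p' :: real
    and k :: nat
    and h \<eta> :: "'a set \<Rightarrow> real"
    and C12 :: "'a set \<Rightarrow> 'a"
    and f gD :: "'a \<Rightarrow> real"
    and gN :: "'a \<Rightarrow> 'a"
  assumes "1 < p" and "1 / p + 1 / p' = 1"
    and "polyhedral_domain \<Omega>"
    and "frontier \<Omega> = \<Gamma>D \<union> \<Gamma>N" and "\<Gamma>D \<inter> \<Gamma>N = {}"
    and "simplicial_mesh \<Omega> T"
    and "\<forall>e\<in>boundary_faces \<Omega> T. (rel_interior e \<subseteq> \<Gamma>D) \<noteq> (rel_interior e \<subseteq> \<Gamma>N)"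
    and "0 < (\<Sum>e\<in>faces_in \<Omega> T \<Gamma>D. measure (face_measure e) e)"
    and "\<forall>e\<in>interior_faces T \<union> boundary_faces \<Omega> T. 0 < h e \<and> 0 < \<eta> e"
    and "dual_data_dom p p' \<Omega> f"
    and "gD \<in> Wsp_faces (1 / p') p (faces_in \<Omega> T \<Gamma>D)"
    and "dual_data_faces (1 / p') p p' (faces_in \<Omega> T \<Gamma>N) (\<lambda>e x. gN x \<bullet> bd_normal T e)"
  shows "{u. weak_solution p k \<Omega> \<Gamma>D \<Gamma>N T h \<eta> C12 f gD gN u} =
         {u. is_arg_min (J_h p k \<Omega> \<Gamma>D \<Gamma>N T h \<eta> C12 f gD gN) (\<lambda>v. v \<in> V_h k T) u}"
proof -
  interpret dg_mesh \<Omega> T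
    using assms by unfold_locales
  have face: "e \<in> sets (face_measure e)" "finite_measure (face_space e)"
    if "e \<in> faces_in \<Omega> T \<Gamma>" for e \<Gamma>
    using that boundary_face[of e] unfolding faces_in_def
    by (auto intro: compact_in_face_measure finite_face_measure)
  \<comment> \<open>Conjugacy with 1 < p makes 1/p' positive, which also rules out p' = 0 with its
    default quotient 0, and at most 1. Hence p' >= 1, and data in the Lebesgue space of exponent p'
    are integrable over finite measures.\<close>
  have "1 / p < 1" "1 / p' = 1 - 1 / p" "0 < 1 / p"
    using assms(1,2) by auto
  then have "0 < 1 / p'" "1 / p' \<le> 1"
    by linarith+
  then have p': "1 \<le> p'"
    by (simp add: divide_le_eq_1)
  interpret dg_problem \<Omega> T p k \<Gamma>D \<Gamma>N h \<eta> C12 f gD gN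
  proof
    have "Lp_on p' lebesgue \<Omega> f"
      using assms by (simp add: dual_data_dom_def)
    then have "Lp_fun p' (lebesgue_on \<Omega>) f"
      using open_dom by (intro Lp_on_imp_Lp_fun) auto
    then show "integrable (lebesgue_on \<Omega>) f"
      using p' by (rule dom.Lp_fun_integrable)
    show "Lp_fun p (face_space e) gD" if "e \<in> faces_in \<Omega> T \<Gamma>D" for e
      using assms(11) that face by (intro Lp_on_imp_Lp_fun) (auto simp: Wsp_faces_def)
    show "integrable (face_space e) (\<lambda>x. gN x \<bullet> bd_normal T e)" if "e \<in> faces_in \<Omega> T \<Gamma>N" for e
    proof -
      have "Lp_fun p' (face_space e) (\<lambda>x. gN x \<bullet> bd_normal T e)"
        using assms(12) that face by (intro Lp_on_imp_Lp_fun) (auto simp: dual_data_faces_def)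
      then show ?thesis
        using p' by (rule finite_measure.Lp_fun_integrable[OF face(2)[OF that]])
    qed
  qed (use assms in auto)
  show ?thesis
    by (simp only: weak_solution_iff minimizer_iff)
qed

end
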